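(* Let the offspring distribution be Poisson$(\lambda)$ and $k=2$. Then: (i) for $\lambda\ge2$, the function $H_{2,\lambda}$ is strictly convex on the interval $[0,c_{2,\lambda}]$; (ii) the slope $H_{2,\lambda}'(c_{2,\lambda})$ of $H_{2,\lambda}$ at $c_{2,\lambda}$ is strictly increasing as a function of $\lambda$, for all $\lambda\ge1$; (iii) as a consequence, there is a unique critical $\lambda_c\approx2.41$ such that $nd_{2,\lambda}=0$ for all $2\le\lambda<\lambda_c$, and $nd_{2,\lambda}>0$ for all $\lambda>\lambda_c$, where $nd_{2,\lambda}$ is the probability that the $2$-jump normal game started at the root of the Galton-Watson tree with Poisson$(\lambda)$ offspring ends in a draw.
   Context: $G_\lambda(x)=e^{\lambda(x-1)}$ is the probability generating function of Poisson$(\lambda)$, $\lambda>0$. $F_{0,\lambda}(x)=1$; $F_{1,\lambda}(x)=G_\lambda(1-x)=e^{-\lambda x}$ on $[0,1]$, with unique fixed point $c_{1,\lambda}$; $F_{2,\lambda}(x)=G_\lambda(F_{1,\lambda}(x)-x)=\exp\{\lambda e^{-\lambda x}-\lambda x-\lambda\}$ on $[0,c_{1,\lambda}]$, with unique fixed point $c_{2,\lambda}$ (it is known that $0<c_{2,\lambda}<c_{1,\lambda}<1$). The function $H_{2,\lambda}:[0,c_{1,\lambda}]\to[0,1]$ is $$H_{2,\lambda}(x)=G_\lambda\big(G_\lambda(1-F_{2,\lambda}(x))-G_\lambda(F_{1,\lambda}(x)-F_{2,\lambda}(x))\big).$$ Game. In the Galton-Watson tree every vertex independently has a Poisson$(\lambda)$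 number of children. In the $2$-jump normal game a token starts at a vertex; two players alternate, a move relocating the token from its current vertex to any child or grandchild of it. A player unable to move loses. The whole tree is known to both players and both play optimally; a game that goes on forever is a draw. *)

theory Defs
  imports "HOL-Probability.Probability"
begin

section \<open>Strict convexity\<close>

definition strict_convex_on :: "real set \<Rightarrow> (real \<Rightarrow> real) \<Rightarrow> bool" where
  "strict_convex_on A f \<longleftrightarrow> convex A \<and>
     (\<forall>x\<in>A. \<forall>y\<in>A. \<forall>t. x \<noteq> y \<and> 0 < t \<and> t < 1 \<longrightarrow>
        f ((1 - t) * x + t * y) < (1 - t) * f x + t * f y)"


section \<open>The functions attached to the Poisson generating function\<close>

text \<open>
  All functions are given by their formulas on the whole real line. On paper \<open>F1 l\<close> lives on
  the interval from 0 to 1, while \<open>F2 l\<close> and \<open>H2 l\<close> live on the interval from 0 to \<open>c1 l\<close>;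
  these domains enter through \<open>c1\<close>, \<open>c2\<close> and the places where the functions are used.
\<close>

definition G :: "real \<Rightarrow> real \<Rightarrow> real" where
  "G l x = exp (l * (x - 1))"

definition F1 :: "real \<Rightarrow> real \<Rightarrow> real" where
  "F1 l x = G l (1 - x)"

definition c1 :: "real \<Rightarrow> real" where
  "c1 l = (THE x. x \<in> {0..1} \<and> F1 l x = x)"

definition F2 :: "real \<Rightarrow> real \<Rightarrow> real" where
  "F2 l x = G l (F1 l x - x)"

definition c2 :: "real \<Rightarrow> real" where
  "c2 l = (THE x. x \<in> {0..c1 l} \<and> F2 l x = x)"

definition H2 :: "real \<Rightarrow> real \<Rightarrow> real" where
  "H2 l x = G l (G l (1 - F2 l x) - G l (F1 l x - F2 l x))"


section \<open>Two-player games on a directed graph\<close>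

text \<open>
  \<open>R u v\<close> means that the token may be moved from \<open>u\<close> to \<open>v\<close>. A history is the nonempty list of
  the positions visited so far, in chronological order, including the current one. The player who
  moves first is \<open>True\<close>, the other one is \<open>False\<close>. A strategy may depend on the whole history.
\<close>

definition to_move :: "'v list \<Rightarrow> bool" where
  "to_move h \<longleftrightarrow> odd (length h)"

definition consistent_history ::
    "('v \<Rightarrow> 'v \<Rightarrow> bool) \<Rightarrow> 'v \<Rightarrow> bool \<Rightarrow> ('v list \<Rightarrow> 'v) \<Rightarrow> 'v list \<Rightarrow> bool" where
  "consistent_history R s p strat h \<longleftrightarrow>
     h \<noteq> [] \<and> hd h = s \<and> successively R h \<and>
     (\<forall>n. 0 < n \<and> n < length h \<and> to_move (take n h) = p \<longrightarrow> h ! n = strat (take n h))"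

text \<open>
  A strategy of player \<open>p\<close> wins if it always supplies a legal move when \<open>p\<close> has to move (so that
  \<open>p\<close> never gets stuck) and no infinite play follows it. Every play that follows it then ends
  with the opponent being unable to move.
\<close>

definition winning_strategy ::
    "('v \<Rightarrow> 'v \<Rightarrow> bool) \<Rightarrow> 'v \<Rightarrow> bool \<Rightarrow> ('v list \<Rightarrow> 'v) \<Rightarrow> bool" where
  "winning_strategy R s p strat \<longleftrightarrow>
     (\<forall>h. consistent_history R s p strat h \<and> to_move h = p \<longrightarrow> R (last h) (strat h)) \<and>
     (\<nexists>f. \<forall>n. consistent_history R s p strat (map f [0..<Suc n]))"

definition drawn :: "('v \<Rightarrow> 'v \<Rightarrow> bool) \<Rightarrow> 'v \<Rightarrow> bool" where
  "drawn R s \<longleftrightarrow> (\<forall>p. \<nexists>strat. winning_strategy R s p strat)"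


section \<open>The 2-jump normal game on the Galton-Watson tree\<close>

text \<open>
  Vertices carry Ulam-Harris labels: the root is \<open>[]\<close> and the children of \<open>u\<close> are \<open>u @ [i]\<close> for
  \<open>i < N u\<close>, where \<open>N u\<close> is the number of children of \<open>u\<close>. The numbers \<open>N u\<close> are drawn
  independently for all labels; labels not reachable from the root are not part of the tree and
  play no role.
\<close>

definition is_child :: "(nat list \<Rightarrow> nat) \<Rightarrow> nat list \<Rightarrow> nat list \<Rightarrow> bool" where
  "is_child N u v \<longleftrightarrow> (\<exists>i < N u. v = u @ [i])"

definition jump2 :: "(nat list \<Rightarrow> nat) \<Rightarrow> nat list \<Rightarrow> nat list \<Rightarrow> bool" where
  "jump2 N u v \<longleftrightarrow> is_child N u v \<or> (\<exists>x. is_child N u x \<and> is_child N x v)"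

definition galton_watson :: "nat pmf \<Rightarrow> (nat list \<Rightarrow> nat) measure" where
  "galton_watson q = PiM UNIV (\<lambda>_. measure_pmf q)"

text \<open>The number \<open>nd2 l\<close> is meaningful for positive \<open>l\<close> only, like \<open>poisson_pmf l\<close>.\<close>

definition nd2 :: "real \<Rightarrow> real" where
  "nd2 l = measure (galton_watson (poisson_pmf l))
             {N \<in> space (galton_watson (poisson_pmf l)). drawn (jump2 N) []}"

definition critical :: "real \<Rightarrow> bool" where
  "critical lc \<longleftrightarrow> (\<forall>l. 2 \<le> l \<and> l < lc \<longrightarrow> nd2 l = 0) \<and> (\<forall>l > lc. nd2 l > 0)"

end

theory Submission
  imports Defs
begin

text \<open>
  A vertex is lost if all its options are won, and won if some option is lost. Counting the rounds
  needed, let \<open>Lose n\<close> and \<open>Win n\<close> be the events that the root is decided within \<open>n\<close> rounds. The root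
  is lost iff each child, together with all children of that child, is won; it fails to be won iff no
  child and no grandchild is lost. The subtrees at the children are independent copies of the tree,
  so requiring an event of probability \<open>p\<close> in each of them has probability \<open>G l p\<close>
  (\<open>prob_all_children_poisson\<close>). Inclusion-exclusion turns the two descriptions into
  \<open>P (- Win (Suc n)) = F2 l (P (Lose n))\<close> and \<open>P (Lose (Suc n)) = H2 l (P (Lose n))\<close>. Hence the
  probability of a loss is the limit \<open>L\<close> of the iterates of \<open>H2 l\<close> at 0, and the probability of a
  draw is \<open>F2 l L - L\<close> (\<open>nd2_eq\<close>). That undecided positions are exactly the drawn ones in the sense
  of strategies is \<open>drawn_iff\<close>, which rests on finite branching.

  Since \<open>c2 l\<close> is a fixed point of the function \<open>H2 l\<close>, which increases on the nonnegative
  numbers, always \<open>L \<le> c2 l\<close>, and as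
  \<open>F2 l\<close> is decreasing, a draw has positive probability iff \<open>L < c2 l\<close>, that is, iff \<open>H2 l\<close> has a
  fixed point below \<open>c2 l\<close>. If the slope of \<open>H2 l\<close> at \<open>c2 l\<close> exceeds 1, the graph lies below the
  diagonal just left of \<open>c2 l\<close> and traps the iterates there (\<open>nd2_pos\<close>); if \<open>l \<ge> 2\<close> and the slope
  is at most 1, strict convexity keeps the graph above the diagonal (\<open>nd2_eq_0\<close>). For \<open>l \<ge> 1\<close> the
  slope grows with \<open>l\<close>, so the supremum of all \<open>l \<ge> 2\<close> with slope at most 1 separates the two cases,
  and Taylor bounds at 2.406 and 2.414 locate it.

  Both analytic parts become elementary in the variables \<open>A = l * F1 l x\<close> and \<open>z = l * F2 l x\<close>: every
  function involved is then obtained from \<open>A\<close>, \<open>z\<close> and \<open>l\<close> by arithmetic and the exponential, and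
  \<open>z = A * exp (A - l)\<close>. Convexity is \<open>convexity_inequality\<close> and needs that \<open>x \<le> c2 l\<close>, in the form
  \<open>l \<le> A * exp z\<close>. At \<open>x = c2 l\<close> one has \<open>z = t\<close> and \<open>A = l * exp (- t)\<close> with \<open>t = l * c2 l\<close>, the slope
  is the polynomial \<open>t\<^sup>2 * (A\<^sup>2 + 2 * A - t * (1 + A))\<close>, and implicit differentiation of \<open>t\<close> reduces
  monotonicity to \<open>slope_growth_inequality\<close>.
\<close>

section \<open>Games with finite branching\<close>

text \<open>
  The index bounds the number of turns that the winning player still takes.
\<close>

primrec win_in :: "('v \<Rightarrow> 'v \<Rightarrow> bool) \<Rightarrow> nat \<Rightarrow> 'v set" where
  "win_in R 0 = {}"
| "win_in R (Suc n) = {v. \<exists>w. R v w \<and> (\<forall>x. R w x \<longrightarrow> x \<in> win_in R n)}"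

definition lose_in :: "('v \<Rightarrow> 'v \<Rightarrow> bool) \<Rightarrow> nat \<Rightarrow> 'v set" where
  "lose_in R n = {v. \<forall>w. R v w \<longrightarrow> w \<in> win_in R n}"

lemma win_in_Suc_iff: "v \<in> win_in R (Suc n) \<longleftrightarrow> (\<exists>w. R v w \<and> w \<in> lose_in R n)"
  by (simp add: lose_in_def)

lemma win_in_mono: "m \<le> n \<Longrightarrow> win_in R m \<subseteq> win_in R n"
proof (rule lift_Suc_mono_le[of "win_in R"])
  fix n show "win_in R n \<subseteq> win_in R (Suc n)"
    by (induction n) auto
qed

lemma lose_in_mono: "m \<le> n \<Longrightarrow> lose_in R m \<subseteq> lose_in R n"
  using win_in_mono[of m n R] by (auto simp: lose_in_def)

text \<open>
  A position that is both won and lost would have an option that is both lost and won, with a smaller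
  sum of the indices; this descends forever.
\<close>

lemma win_lose_disjoint: "v \<in> win_in R m \<Longrightarrow> v \<notin> lose_in R n"
proof (induction "m + n" arbitrary: m n v rule: less_induct)
  case less
  show ?case
  proof
    assume vL: "v \<in> lose_in R n"
    obtain m' where m': "m = Suc m'" using less.prems by (cases m) auto
    obtain w where w: "R v w" "w \<in> lose_in R m'"
      using less.prems unfolding m' win_in_Suc_iff by blast
    have "w \<in> win_in R n" using vL w(1) by (auto simp: lose_in_def)
    then show False using less.hyps[of n m' w] w(2) m' by simp
  qed
qed

text \<open>
  Finite branching enters here: the finitely many options, each won within some number of rounds, are
  all won within a common number of rounds.
\<close>

lemma no_escape_finite_branching:
  assumes fin: "finite {w. R v w}" and sub: "\<And>w. R v w \<Longrightarrow> w \<in> (\<Union>n. win_in R n)"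
  shows "v \<in> (\<Union>n. lose_in R n)"
proof -
  have "\<forall>w. \<exists>n. R v w \<longrightarrow> w \<in> win_in R n" using sub by blast
  then obtain k where k: "\<And>w. R v w \<Longrightarrow> w \<in> win_in R (k w)" by metis
  have "w \<in> win_in R (Max (k ` {w. R v w}))" if "R v w" for w
    using win_in_mono[of "k w" "Max (k ` {w. R v w})" R] k[OF that] that fin
    by (auto intro: Max_ge)
  then show ?thesis by (auto simp: lose_in_def)
qed

lemma consistent_history_snoc:
  assumes "h \<noteq> []"
  shows "consistent_history R s p strat (h @ [w]) \<longleftrightarrow>
     consistent_history R s p strat h \<and> R (last h) w \<and> (to_move h = p \<longrightarrow> w = strat h)"
proof -
  have "(\<forall>n. 0 < n \<and> n < length (h @ [w]) \<and> to_move (take n (h @ [w])) = p \<longrightarrow>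
           (h @ [w]) ! n = strat (take n (h @ [w]))) \<longleftrightarrow>
        (\<forall>n. 0 < n \<and> n < length h \<and> to_move (take n h) = p \<longrightarrow> h ! n = strat (take n h)) \<and>
        (to_move h = p \<longrightarrow> w = strat h)" (is "(\<forall>n. ?A n) \<longleftrightarrow> (\<forall>n. ?B n) \<and> ?C")
  proof -
    have a: "?A n \<longleftrightarrow> (if n = length h then ?C else ?B n)" for n
      using assms by (cases n "length h" rule: linorder_cases) (simp_all add: nth_append)
    have b: "?B (length h)" by simp
    have split: "(\<forall>n. X n) \<longleftrightarrow> (\<forall>n. Y n) \<and> C"
      if "\<And>n. X n \<longleftrightarrow> (if n = m then C else Y n)" "Y m" for X Y :: "nat \<Rightarrow> bool" and C m
      using that by (auto split: if_splits)
    show ?thesis by (rule split[OF a b])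
  qed
  then show ?thesis
    using assms unfolding consistent_history_def
    by (auto simp: successively_append_iff hd_append)
qed

lemma consistent_history_singleton [simp]:
  "consistent_history R s p strat [v] \<longleftrightarrow> v = s"
  by (auto simp: consistent_history_def)

lemma to_move_snoc [simp]: "to_move (h @ [w]) \<longleftrightarrow> \<not> to_move h"
  by (simp add: to_move_def)

text \<open>
  The opponent of \<open>p\<close> can keep to positions that are not decided in favour of \<open>p\<close>. Played against
  any strategy of \<open>p\<close> that always supplies legal moves, this produces an infinite play.
\<close>

lemma no_winning_strategy:
  assumes fin: "\<And>v. finite {w. R v w}"
    and start: "if p then s \<notin> (\<Union>n. win_in R n) else s \<notin> (\<Union>n. lose_in R n)"
  shows "\<not> winning_strategy R s p strat"
proof
  assume ws: "winning_strategy R s p strat"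
  define nxt where
    "nxt h = (if to_move h = p then strat h else (SOME w. R (last h) w \<and> w \<notin> (\<Union>n. win_in R n)))" for h
  define hist where "hist = rec_nat [s] (\<lambda>_ h. h @ [nxt h])"
  have hist0: "hist 0 = [s]" and histS: "hist (Suc n) = hist n @ [nxt (hist n)]" for n
    by (simp_all add: hist_def)
  have inv: "consistent_history R s p strat (hist n) \<and>
      (if to_move (hist n) = p then last (hist n) \<notin> (\<Union>n. win_in R n)
       else last (hist n) \<notin> (\<Union>n. lose_in R n)) \<and> hist n \<noteq> []" for n
  proof (induction n)
    case 0
    then show ?case using start by (cases p) (simp_all add: hist0 to_move_def)
  next
    case (Suc n)
    show ?case
    proof (cases "to_move (hist n) = p")
      case True
      then have R: "R (last (hist n)) (strat (hist n))"
        using ws Suc by (auto simp: winning_strategy_def)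
      have "strat (hist n) \<notin> lose_in R k" for k
      proof
        assume "strat (hist n) \<in> lose_in R k"
        then have "last (hist n) \<in> win_in R (Suc k)" using R win_in_Suc_iff by fast
        then show False using Suc True by (simp del: win_in.simps)
      qed
      then show ?thesis using True R Suc
        by (simp add: histS nxt_def consistent_history_snoc)
    next
      case False
      then have "\<exists>w. R (last (hist n)) w \<and> w \<notin> (\<Union>n. win_in R n)"
        using no_escape_finite_branching[of R "last (hist n)", OF fin] Suc by auto
      from someI_ex[OF this] show ?thesis using False Suc
        by (simp add: histS nxt_def consistent_history_snoc)
    qed
  qed
  define f where "f n = last (hist n)" for n
  have "map f [0..<Suc n] = hist n" for n
    by (induction n) (simp_all add: hist0 histS f_def)
  then have "\<forall>n. consistent_history R s p strat (map f [0..<Suc n])" using inv by simp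
  then show False using ws unfolding winning_strategy_def by blast
qed

text \<open>
  Always moving to a position that is lost within as few rounds as possible wins, because the number
  of rounds decreases strictly with each turn of the winner.
\<close>

lemma ex_winning_strategy:
  assumes start: "if p then s \<in> (\<Union>n. win_in R n) else s \<in> (\<Union>n. lose_in R n)"
  shows "\<exists>strat. winning_strategy R s p strat"
proof -
  define r where "r v = (LEAST n. v \<in> win_in R n)" for v
  define strat where "strat h = (SOME w. R (last h) w \<and> w \<in> lose_in R (r (last h) - 1))" for h
  have r: "v \<in> win_in R (r v)" if "v \<in> (\<Union>n. win_in R n)" for v
    using that unfolding r_def by (auto intro: LeastI)
  have r_le: "r v \<le> n" if "v \<in> win_in R n" for v n
    using that unfolding r_def by (rule Least_le)
  have r_pos: "r v > 0" if "v \<in> (\<Union>n. win_in R n)" for v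
    using r[OF that] by (cases "r v") auto
  have strat: "R (last h) (strat h) \<and> strat h \<in> lose_in R (r (last h) - 1)"
    if "last h \<in> (\<Union>n. win_in R n)" for h
  proof -
    have "last h \<in> win_in R (Suc (r (last h) - 1))" using r[OF that] r_pos[OF that] by simp
    then have "\<exists>w. R (last h) w \<and> w \<in> lose_in R (r (last h) - 1)"
      unfolding win_in_Suc_iff .
    from someI_ex[OF this] show ?thesis unfolding strat_def .
  qed
  have inv: "if to_move h = p then last h \<in> (\<Union>n. win_in R n) else last h \<in> (\<Union>n. lose_in R n)"
    if "consistent_history R s p strat h" for h
    using that
  proof (induction h rule: rev_induct)
    case Nil
    then show ?case by (simp add: consistent_history_def)
  next
    case (snoc w h)
    show ?case
    proof (cases "h = []")
      case True
      then show ?thesis using snoc.prems start by (cases p) (simp_all add: to_move_def)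
    next
      case False
      then have c: "consistent_history R s p strat h" "R (last h) w" "to_move h = p \<Longrightarrow> w = strat h"
        using snoc.prems by (auto simp: consistent_history_snoc)
      note IH = snoc.IH[OF c(1)]
      show ?thesis
      proof (cases "to_move h = p")
        case True
        then show ?thesis using IH c strat[of h] by auto
      next
        case False
        then show ?thesis using IH c(2) by (auto simp: lose_in_def)
      qed
    qed
  qed
  have "\<not> (\<forall>n. consistent_history R s p strat (map f [0..<Suc n]))" for f
  proof
    assume f: "\<forall>n. consistent_history R s p strat (map f [0..<Suc n])"
    define h where "h n = map f [0..<Suc n]" for n
    have h: "consistent_history R s p strat (h n)" "last (h n) = f n"
      "to_move (h n) \<longleftrightarrow> even n" "h n \<noteq> []" "h (Suc n) = h n @ [f (Suc n)]" for n
      using f by (auto simp: h_def to_move_def)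
    have desc: "r (f (Suc (Suc n))) < r (f n)" if n: "even n = p" for n
    proof -
      have W: "f n \<in> (\<Union>n. win_in R n)" using inv[OF h(1)[of n]] n h by simp
      have "f (Suc n) = strat (h n)"
        using h(1)[of "Suc n"] n unfolding h(5) consistent_history_snoc[OF h(4)] by (simp add: h)
      then have "f (Suc n) \<in> lose_in R (r (f n) - 1)" using strat[of "h n"] W h by simp
      moreover have "R (f (Suc n)) (f (Suc (Suc n)))"
        using h(1)[of "Suc (Suc n)"] unfolding h(5)[of "Suc n"] consistent_history_snoc[OF h(4)]
        by (simp add: h)
      ultimately have "f (Suc (Suc n)) \<in> win_in R (r (f n) - 1)" by (auto simp: lose_in_def)
      from r_le[OF this] r_pos[OF W] show ?thesis by simp
    qed
    \<comment> \<open>the first turn of \<open>p\<close>\<close>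
  define n0 :: nat where "n0 = (if p then 0 else 1)"
    have "r (f (n0 + 2 * k)) + k \<le> r (f n0)" for k
    proof (induction k)
      case (Suc k)
      have "even (n0 + 2 * k) = p" by (simp add: n0_def)
      from desc[OF this] Suc show ?case by simp
    qed simp
    from this[of "Suc (r (f n0))"] show False by simp
  qed
  moreover have "R (last h) (strat h)"
    if "consistent_history R s p strat h" "to_move h = p" for h
    using inv[OF that(1)] that(2) strat[of h] by simp
  ultimately have "winning_strategy R s p strat" by (auto simp: winning_strategy_def)
  then show ?thesis by blast
qed

theorem drawn_iff:
  assumes fin: "\<And>v. finite {w. R v w}"
  shows "drawn R s \<longleftrightarrow> s \<notin> (\<Union>n. win_in R n) \<and> s \<notin> (\<Union>n. lose_in R n)"
proof -
  have "(\<exists>strat. winning_strategy R s True strat) \<longleftrightarrow> s \<in> (\<Union>n. win_in R n)"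
    using no_winning_strategy[of R True s, OF fin] ex_winning_strategy[of True s R] by auto
  moreover have "(\<exists>strat. winning_strategy R s False strat) \<longleftrightarrow> s \<in> (\<Union>n. lose_in R n)"
    using no_winning_strategy[of R False s, OF fin] ex_winning_strategy[of False s R] by auto
  ultimately show ?thesis unfolding drawn_def by (metis (full_types))
qed

section \<open>Independence of subtrees in the Galton-Watson tree\<close>

definition subtree :: "nat list \<Rightarrow> (nat list \<Rightarrow> nat) \<Rightarrow> (nat list \<Rightarrow> nat)" where
  "subtree u N = (\<lambda>v. N (u @ v))"

definition all_children :: "(nat list \<Rightarrow> nat) set \<Rightarrow> (nat list \<Rightarrow> nat) set" where
  "all_children E = {N. \<forall>i < N []. subtree [i] N \<in> E}"

lemma subtree_Nil [simp]: "subtree [] N = N"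
  and subtree_subtree: "subtree u (subtree v N) = subtree (v @ u) N"
  by (simp_all add: subtree_def)

lemma space_galton_watson [simp]: "space (galton_watson q) = UNIV"
  by (simp add: galton_watson_def space_PiM)

lemma prob_space_galton_watson: "prob_space (galton_watson q)"
  unfolding galton_watson_def by (intro prob_space_PiM measure_pmf.prob_space_axioms)

lemma measurable_offspring [measurable]:
  "(\<lambda>N. N u) \<in> galton_watson q \<rightarrow>\<^sub>M count_space UNIV"
proof -
  have "(\<lambda>N. N u) \<in> galton_watson q \<rightarrow>\<^sub>M measure_pmf q"
    unfolding galton_watson_def by (rule measurable_component_singleton) simp
  then show ?thesis by (simp cong: measurable_cong_sets)
qed

lemma measurable_subtree [measurable]:
  "subtree u \<in> galton_watson q \<rightarrow>\<^sub>M galton_watson q"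
proof -
  have "(\<lambda>N. N (u @ v)) \<in> galton_watson q \<rightarrow>\<^sub>M measure_pmf q" for v
    using measurable_offspring by (simp cong: measurable_cong_sets)
  then have "(\<lambda>N v. N (u @ v)) \<in> galton_watson q \<rightarrow>\<^sub>M Pi\<^sub>M UNIV (\<lambda>_. measure_pmf q)"
    by (intro measurable_PiM_single') (auto simp: space_PiM)
  then show ?thesis by (simp add: galton_watson_def subtree_def[abs_def])
qed

lemma all_children_measurable [measurable]:
  assumes [measurable]: "E \<in> sets (galton_watson q)"
  shows "all_children E \<in> sets (galton_watson q)"
proof -
  have "{N \<in> space (galton_watson q). \<forall>i. i < N [] \<longrightarrow> subtree [i] N \<in> E} \<in> sets (galton_watson q)"
    by measurable
  then show ?thesis by (simp add: all_children_def)
qed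

lemma distr_subtree: "distr (galton_watson q) (galton_watson q) (subtree u) = galton_watson q"
proof -
  have "distr (Pi\<^sub>M UNIV (\<lambda>_::nat list. measure_pmf q)) (Pi\<^sub>M UNIV (\<lambda>_::nat list. measure_pmf q))
          (\<lambda>\<omega>. \<lambda>n\<in>UNIV. \<omega> (u @ n)) = Pi\<^sub>M UNIV (\<lambda>_::nat list. measure_pmf q)"
    by (rule distr_PiM_reindex[where f = "\<lambda>v. u @ v" and M = "\<lambda>_. measure_pmf q"])
      (auto intro: injI measure_pmf.prob_space_axioms)
  then show ?thesis by (simp add: galton_watson_def subtree_def[abs_def] restrict_UNIV)
qed

lemma prob_subtree:
  assumes [measurable]: "E \<in> sets (galton_watson q)"
  shows "measure (galton_watson q) {N. subtree u N \<in> E} = measure (galton_watson q) E"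
proof -
  have "measure (galton_watson q) E = measure (distr (galton_watson q) (galton_watson q) (subtree u)) E"
    by (simp add: distr_subtree)
  also have "\<dots> = measure (galton_watson q) {N. subtree u N \<in> E}"
    by (subst measure_distr) (auto simp: vimage_def)
  finally show ?thesis ..
qed

lemma prob_offspring:
  "measure (galton_watson q) {N. N u = n} = pmf q n"
proof -
  have "distr (Pi\<^sub>M UNIV (\<lambda>_::nat list. measure_pmf q)) (measure_pmf q) (\<lambda>\<omega>. \<omega> u) = measure_pmf q"
    by (rule distr_PiM_component) (auto intro: measure_pmf.prob_space_axioms)
  then have "pmf q n = measure (distr (galton_watson q) (measure_pmf q) (\<lambda>\<omega>. \<omega> u)) {n}"
    by (simp add: galton_watson_def pmf.rep_eq)
  also have "\<dots> = measure (galton_watson q) {N. N u = n}"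
    using measurable_offspring[of u q]
    by (subst measure_distr) (auto simp: vimage_def cong: measurable_cong_sets)
  finally show ?thesis ..
qed

text \<open>
  The offspring number of the root and the subtrees at its children are functions of disjoint sets of
  coordinates of the product space.
\<close>

lemma indep_root_and_subtrees:
  assumes E [measurable]: "E \<in> sets (galton_watson q)"
  shows "measure (galton_watson q) {N. N [] = n \<and> (\<forall>i<k. subtree [i] N \<in> E)}
       = pmf q n * measure (galton_watson q) E ^ k"
proof -
  interpret prob_space "galton_watson q" by (rule prob_space_galton_watson)
  define M where "M = galton_watson q"
  \<comment> \<open>\<open>None\<close> indexes the coordinate of the root, \<open>Some i\<close> those of the subtree at child \<open>i\<close>\<close>
  define K :: "nat option \<Rightarrow> nat list set" where
    "K j = (case j of None \<Rightarrow> {[]} | Some i \<Rightarrow> range ((#) i))" for j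
  define P :: "nat option \<Rightarrow> (nat list \<Rightarrow> nat) measure" where
    "P j = Pi\<^sub>M (K j) (\<lambda>_. measure_pmf q)" for j
  have "indep_vars (\<lambda>_. measure_pmf q) (\<lambda>i N. N i) UNIV"
  proof (subst indep_vars_iff_distr_eq_PiM)
    show "distr (galton_watson q) (Pi\<^sub>M UNIV (\<lambda>_. measure_pmf q)) (\<lambda>N. \<lambda>i\<in>UNIV. N i) =
        Pi\<^sub>M UNIV (\<lambda>i. distr (galton_watson q) (measure_pmf q) (\<lambda>N. N i))"
      unfolding galton_watson_def
      by (subst distr_PiM_component) (auto intro: measure_pmf.prob_space_axioms simp: restrict_UNIV)
    show "random_variable (measure_pmf q) (\<lambda>N. N i)" for i
      using measurable_offspring by (simp cong: measurable_cong_sets)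
  qed simp
  then have ind: "indep_vars P (\<lambda>j N. restrict N (K j)) UNIV"
    unfolding P_def
    by (rule indep_vars_restrict) (auto simp: K_def disjoint_family_on_def split: option.splits)
  define J :: "nat option set" where "J = insert None (Some ` {..<k})"
  define D where "D j = (case j of None \<Rightarrow> {g \<in> space (P None). g [] = n}
      | Some i \<Rightarrow> {g \<in> space (P (Some i)). (\<lambda>v. g (i # v)) \<in> E})" for j
  have D: "D j \<in> sets (P j)" for j
  proof (cases j)
    case None
    have "(\<lambda>g. g []) \<in> P None \<rightarrow>\<^sub>M measure_pmf q"
      unfolding P_def by (rule measurable_component_singleton) (simp add: K_def)
    from measurable_sets[OF this, of "{n}"] show ?thesis
      by (simp add: D_def None vimage_def Int_def conj_commute)
  next
    case (Some i)
    have "(\<lambda>g. g (i # v)) \<in> P (Some i) \<rightarrow>\<^sub>M measure_pmf q" for v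
      unfolding P_def by (rule measurable_component_singleton) (simp add: K_def)
    then have [measurable]: "(\<lambda>g v. g (i # v)) \<in> P (Some i) \<rightarrow>\<^sub>M galton_watson q"
      unfolding galton_watson_def by (intro measurable_PiM_single') (auto simp: space_PiM)
    have "{g \<in> space (P (Some i)). (\<lambda>v. g (i # v)) \<in> E} \<in> sets (P (Some i))" by measurable
    then show ?thesis by (simp add: D_def Some)
  qed
  have pre: "(\<lambda>N. restrict N (K j)) -` D j =
      (case j of None \<Rightarrow> {N. N [] = n} | Some i \<Rightarrow> {N. subtree [i] N \<in> E})" for j
    by (auto simp: D_def P_def K_def space_PiM subtree_def split: option.splits)
  have "{N. N [] = n \<and> (\<forall>i<k. subtree [i] N \<in> E)} =
      (\<Inter>j\<in>J. (\<lambda>N. restrict N (K j)) -` D j \<inter> space (galton_watson q))"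
    by (auto simp: J_def pre)
  also have "prob \<dots> = (\<Prod>j\<in>J. prob ((\<lambda>N. restrict N (K j)) -` D j \<inter> space (galton_watson q)))"
    using D by (intro indep_varsD[OF ind]) (auto simp: J_def)
  also have "\<dots> = pmf q n * (\<Prod>i<k. prob E)"
    unfolding J_def by (subst prod.insert) (auto simp: pre prod.reindex prob_offspring prob_subtree)
  finally show ?thesis by simp
qed

text \<open>
  The value of the generating function of \<open>q\<close> at the probability of \<open>E\<close>, obtained by conditioning on
  the offspring number of the root.
\<close>

lemma prob_all_children:
  assumes E [measurable]: "E \<in> sets (galton_watson q)"
  shows "(\<lambda>n. pmf q n * measure (galton_watson q) E ^ n) sums measure (galton_watson q) (all_children E)"
proof -
  interpret prob_space "galton_watson q" by (rule prob_space_galton_watson)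
  define A where "A n = {N. N [] = n \<and> (\<forall>i<n. subtree [i] N \<in> E)}" for n
  have "{N \<in> space (galton_watson q). N [] = n \<and> (\<forall>i<n. subtree [i] N \<in> E)} \<in> sets (galton_watson q)" for n
    by measurable
  then have "(\<lambda>n. prob (A n)) sums prob (\<Union>n. A n)"
    by (intro finite_measure_UNION) (auto simp: A_def disjoint_family_on_def)
  moreover have "(\<Union>n. A n) = all_children E" by (auto simp: A_def all_children_def)
  ultimately show ?thesis by (simp add: A_def indep_root_and_subtrees)
qed

lemma prob_all_children_poisson:
  assumes l: "0 < l" and E: "E \<in> sets (galton_watson (poisson_pmf l))"
  shows "measure (galton_watson (poisson_pmf l)) (all_children E)
       = G l (measure (galton_watson (poisson_pmf l)) E)"
proof -
  define p where "p = measure (galton_watson (poisson_pmf l)) E"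
  have "(\<lambda>n. exp (- l) * ((l * p) ^ n /\<^sub>R fact n)) sums (exp (- l) * exp (l * p))"
    by (intro sums_mult exp_converges)
  moreover have "exp (- l) * ((l * p) ^ n /\<^sub>R fact n) = pmf (poisson_pmf l) n * p ^ n" for n
    using l by (simp add: power_mult_distrib field_simps)
  ultimately have "(\<lambda>n. pmf (poisson_pmf l) n * p ^ n) sums G l p"
    by (simp add: G_def flip: exp_add) (simp add: algebra_simps)
  then show ?thesis using prob_all_children[OF E] sums_unique2 unfolding p_def by blast
qed

section \<open>The probability of a draw\<close>

definition Win :: "nat \<Rightarrow> (nat list \<Rightarrow> nat) set" where
  "Win n = {N. [] \<in> win_in (jump2 N) n}"

definition Lose :: "nat \<Rightarrow> (nat list \<Rightarrow> nat) set" where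
  "Lose n = {N. [] \<in> lose_in (jump2 N) n}"

lemma is_child_subtree: "is_child N (v @ u) w \<longleftrightarrow> (\<exists>x. w = v @ x \<and> is_child (subtree v N) u x)"
  by (auto simp: is_child_def subtree_def)

lemma jump2_subtree: "jump2 N (v @ u) w \<longleftrightarrow> (\<exists>x. w = v @ x \<and> jump2 (subtree v N) u x)"
  unfolding jump2_def by (auto simp: is_child_subtree)

text \<open>
  Moves lead downwards only, so the status of a vertex depends on nothing but its subtree.
\<close>

lemma win_in_subtree: "v @ u \<in> win_in (jump2 N) n \<longleftrightarrow> u \<in> win_in (jump2 (subtree v N)) n"
proof -
  have "(\<exists>w. jump2 N (v @ u) w \<and> P w) \<longleftrightarrow> (\<exists>x. jump2 (subtree v N) u x \<and> P (v @ x))"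
    and "(\<forall>w. jump2 N (v @ u) w \<longrightarrow> P w) \<longleftrightarrow> (\<forall>x. jump2 (subtree v N) u x \<longrightarrow> P (v @ x))" for u P
    by (auto simp: jump2_subtree)
  then show ?thesis by (induction n arbitrary: u) simp_all
qed

lemma child_win: "[i] \<in> win_in (jump2 N) n \<longleftrightarrow> subtree [i] N \<in> Win n"
  and grandchild_win: "[i, j] \<in> win_in (jump2 N) n \<longleftrightarrow> subtree [j] (subtree [i] N) \<in> Win n"
  using win_in_subtree[of "[i]" "[]" N n] win_in_subtree[of "[i, j]" "[]" N n]
  by (simp_all add: Win_def subtree_subtree)

lemma jump2_root: "jump2 N [] w \<longleftrightarrow> (\<exists>i<N []. w = [i] \<or> (\<exists>j<subtree [i] N []. w = [i, j]))"
  by (auto simp: jump2_def is_child_def subtree_def)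

lemma finite_jump2: "finite {w. jump2 N v w}"
proof -
  have "{w. is_child N u w} = (\<lambda>i. u @ [i]) ` {..<N u}" for u
    by (auto simp: is_child_def)
  then have fin: "finite {w. is_child N u w}" for u by simp
  have "{w. jump2 N v w} = {w. is_child N v w} \<union> (\<Union>x\<in>{x. is_child N v x}. {w. is_child N x w})"
    by (auto simp: jump2_def)
  then show ?thesis using fin by simp
qed

lemma Win_0: "Win 0 = {}" by (simp add: Win_def)

lemma Lose_eq: "Lose n = all_children (Win n \<inter> all_children (Win n))"
proof -
  have "N \<in> Lose n \<longleftrightarrow> (\<forall>i<N []. [i] \<in> win_in (jump2 N) n \<and>
      (\<forall>j<subtree [i] N []. [i, j] \<in> win_in (jump2 N) n))" for N
  proof -
    have "N \<in> Lose n \<longleftrightarrow> (\<forall>w. jump2 N [] w \<longrightarrow> w \<in> win_in (jump2 N) n)"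
      by (simp add: Lose_def lose_in_def)
    then show ?thesis unfolding jump2_root by blast
  qed
  then show ?thesis
    by (auto simp: all_children_def child_win grandchild_win)
qed

text \<open>
  The condition on the children removes from an event a smaller one, by \<open>Lose_subset\<close> (a lost vertex
  has no lost child), so that its probability is a difference of probabilities. The same holds for
  \<open>Lose_Suc\<close>, by \<open>Compl_Win_subset\<close>.
\<close>

lemma Compl_Win_Suc: "- Win (Suc n) = all_children (all_children (- Lose n) - Lose n)"
proof -
  have "u \<in> lose_in (jump2 N) n \<longleftrightarrow> subtree u N \<in> Lose n" for u N
  proof -
    have "jump2 N u w \<longleftrightarrow> (\<exists>x. w = u @ x \<and> jump2 (subtree u N) [] x)" for w
      using jump2_subtree[of N u "[]" w] by simp
    then show ?thesis by (auto simp: Lose_def lose_in_def win_in_subtree)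
  qed
  then have "N \<in> Win (Suc n) \<longleftrightarrow> (\<exists>i<N []. subtree [i] N \<in> Lose n \<or>
      (\<exists>j<subtree [i] N []. subtree [j] (subtree [i] N) \<in> Lose n))" for N
    unfolding Win_def mem_Collect_eq win_in_Suc_iff jump2_root by (auto simp: subtree_subtree)
  then show ?thesis by (auto simp: all_children_def)
qed

lemma Win_Lose_disjoint: "Win m \<inter> Lose n = {}"
  by (auto simp: Win_def Lose_def dest: win_lose_disjoint)

lemma Lose_subset: "Lose n \<subseteq> all_children (- Lose n)"
proof -
  have "Lose n \<subseteq> all_children (Win n)"
    by (auto simp: Lose_eq all_children_def)
  also have "\<dots> \<subseteq> all_children (- Lose n)"
    using Win_Lose_disjoint[of n n] by (auto simp: all_children_def)
  finally show ?thesis .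
qed

lemma Compl_Win_subset: "- Win (Suc n) \<subseteq> all_children (- Lose n)"
  using Compl_Win_Suc[of n] by (auto simp: all_children_def)

text \<open>
  If all children of a vertex are won but the vertex is not, then each of its children is a won vertex
  without lost children. Subtracting this case from "all children are won" leaves the vertices that
  are won together with all their children, which is what a lost parent requires of its children.
\<close>

lemma Lose_Suc:
  "Lose (Suc n) = all_children (all_children (Win (Suc n)) -
      all_children (all_children (- Lose n) - - Win (Suc n)))"
proof -
  have "all_children (Win (Suc n)) - Win (Suc n)
      = all_children (Win (Suc n)) \<inter> all_children (all_children (- Lose n) - Lose n)"
    using Compl_Win_Suc[of n] by auto
  also have "\<dots> = all_children (all_children (- Lose n) - - Win (Suc n))"
    using Win_Lose_disjoint[of "Suc n" n] by (auto simp: all_children_def)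
  finally have "Win (Suc n) \<inter> all_children (Win (Suc n)) = all_children (Win (Suc n)) -
      all_children (all_children (- Lose n) - - Win (Suc n))"
    by auto
  then show ?thesis by (simp only: Lose_eq)
qed

lemma Win_Lose_measurable:
  "Win n \<in> sets (galton_watson q) \<and> Lose n \<in> sets (galton_watson q)"
proof (induction n)
  case 0
  then show ?case by (auto simp: Win_0 Lose_eq intro!: all_children_measurable)
next
  case (Suc n)
  have compl: "- A \<in> sets (galton_watson q)" if "A \<in> sets (galton_watson q)" for A
    using sets.compl_sets[OF that] by (simp add: Compl_eq_Diff_UNIV)
  have "- Win (Suc n) \<in> sets (galton_watson q)"
    unfolding Compl_Win_Suc using Suc compl
    by (auto intro!: all_children_measurable sets.Diff)
  from compl[OF this] have W: "Win (Suc n) \<in> sets (galton_watson q)" by simp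
  then show ?case unfolding Lose_eq
    by (auto intro!: all_children_measurable sets.Int)
qed

lemma measurable_Win [measurable]: "Win n \<in> sets (galton_watson q)"
  and measurable_Lose [measurable]: "Lose n \<in> sets (galton_watson q)"
  using Win_Lose_measurable by auto

context
  fixes l :: real
  assumes l: "0 < l"
begin

abbreviation GW where "GW \<equiv> galton_watson (poisson_pmf l)"

interpretation prob_space GW by (rule prob_space_galton_watson)

lemma prob_AC: "E \<in> events \<Longrightarrow> prob (all_children E) = G l (prob E)"
  using l by (rule prob_all_children_poisson)

lemma compl_event: "E \<in> events \<Longrightarrow> - E \<in> events"
  using sets.compl_sets[of E GW] by (simp add: Compl_eq_Diff_UNIV)

lemma prob_Compl: "E \<in> events \<Longrightarrow> prob (- E) = 1 - prob E"
  using prob_compl[of E] by (simp add: Compl_eq_Diff_UNIV)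

lemmas event_intros = compl_event all_children_measurable sets.Diff measurable_Win measurable_Lose

lemma prob_no_lost_child: "prob (all_children (- Lose n)) = F1 l (prob (Lose n))"
  by (simp add: prob_AC prob_Compl event_intros F1_def)

lemma prob_Compl_Win_Suc: "prob (- Win (Suc n)) = F2 l (prob (Lose n))"
  unfolding Compl_Win_Suc
  by (simp add: prob_AC event_intros finite_measure_Diff Lose_subset prob_no_lost_child F2_def)

lemma prob_Lose_Suc: "prob (Lose (Suc n)) = H2 l (prob (Lose n))"
proof -
  have W: "prob (Win (Suc n)) = 1 - F2 l (prob (Lose n))"
    using prob_Compl[OF measurable_Win, of "Suc n"] prob_Compl_Win_Suc[of n] by simp
  have sub: "all_children (all_children (- Lose n) - - Win (Suc n)) \<subseteq> all_children (Win (Suc n))"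
    by (auto simp: all_children_def)
  have "prob (all_children (- Lose n) - - Win (Suc n))
      = F1 l (prob (Lose n)) - F2 l (prob (Lose n))"
    by (subst finite_measure_Diff)
      (simp_all only: event_intros Compl_Win_subset prob_no_lost_child prob_Compl_Win_Suc)
  then show ?thesis
    unfolding Lose_Suc
    by (simp add: prob_AC event_intros finite_measure_Diff[OF _ _ sub] W H2_def del: Diff_Compl Compl_iff)
qed

lemma prob_Lose: "prob (Lose n) = (H2 l ^^ Suc n) 0"
proof (induction n)
  case 0
  have "Lose 0 = all_children {}" by (auto simp: Lose_eq Win_0)
  then show ?case by (simp add: prob_AC H2_def F1_def F2_def G_def)
next
  case (Suc n)
  then show ?case by (simp add: prob_Lose_Suc)
qed

text \<open>
  The iterates are the probabilities of \<open>Lose\<close>, shifted by one step, so \<open>L\<close> is the probability of a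
  loss and \<open>1 - F2 l L\<close> that of a win.
\<close>

lemma nd2_eq:
  obtains L where "(\<lambda>n. (H2 l ^^ n) 0) \<longlonglongrightarrow> L" "nd2 l = F2 l L - L"
proof -
  define L where "L = prob (\<Union>n. Lose n)"
  have incL: "incseq Lose"
    by (auto simp: incseq_def Lose_def dest: subsetD[OF lose_in_mono])
  have incW: "incseq Win"
    by (auto simp: incseq_def Win_def dest: subsetD[OF win_in_mono])
  have limL: "(\<lambda>n. prob (Lose n)) \<longlonglongrightarrow> L"
    unfolding L_def by (rule finite_Lim_measure_incseq) (auto simp: incL)
  have limW: "(\<lambda>n. prob (Win n)) \<longlonglongrightarrow> prob (\<Union>n. Win n)"
    by (rule finite_Lim_measure_incseq) (auto simp: incW)
  have "prob (Win (Suc n)) = 1 - F2 l (prob (Lose n))" for n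
    using prob_Compl[OF measurable_Win, of "Suc n"] prob_Compl_Win_Suc[of n] by simp
  moreover have "(\<lambda>n. 1 - F2 l (prob (Lose n))) \<longlonglongrightarrow> 1 - F2 l L"
    unfolding F2_def F1_def G_def by (intro tendsto_intros limL)
  ultimately have "(\<lambda>n. prob (Win (Suc n))) \<longlonglongrightarrow> 1 - F2 l L" by simp
  then have W: "prob (\<Union>n. Win n) = 1 - F2 l L"
    using LIMSEQ_unique[OF LIMSEQ_Suc[OF limW]] by simp
  have "{N \<in> space GW. drawn (jump2 N) []} = - ((\<Union>n. Win n) \<union> (\<Union>n. Lose n))"
    by (auto simp: drawn_iff[OF finite_jump2] Win_def Lose_def)
  then have "nd2 l = prob (- ((\<Union>n. Win n) \<union> (\<Union>n. Lose n)))"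
    by (simp only: nd2_def)
  also have "\<dots> = 1 - prob ((\<Union>n. Win n) \<union> (\<Union>n. Lose n))"
    by (rule prob_Compl) measurable
  also have "prob ((\<Union>n. Win n) \<union> (\<Union>n. Lose n)) = prob (\<Union>n. Win n) + L"
    unfolding L_def using Win_Lose_disjoint by (intro finite_measure_Union) auto
  finally have "nd2 l = F2 l L - L" using W by simp
  moreover have "(\<lambda>n. (H2 l ^^ n) 0) \<longlonglongrightarrow> L"
    using limL unfolding prob_Lose by (rule LIMSEQ_imp_Suc)
  ultimately show ?thesis using that by blast
qed

end

section \<open>Bounds for the exponential function\<close>

lemma exp_lower_Taylor: "0 \<le> x \<Longrightarrow> (\<Sum>m<n. x ^ m / fact m) \<le> exp (x::real)"
  using Maclaurin_exp_le[of x n] by auto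

lemma exp_upper_Taylor:
  assumes "0 \<le> x" "x ^ n / fact n < 1"
  shows "exp (x::real) \<le> (\<Sum>m<n. x ^ m / fact m) / (1 - x ^ n / fact n)"
proof -
  obtain t where t: "\<bar>t\<bar> \<le> \<bar>x\<bar>" "exp x = (\<Sum>m<n. x ^ m / fact m) + (exp t / fact n) * x ^ n"
    using Maclaurin_exp_le by blast
  have "exp t * (x ^ n / fact n) \<le> exp x * (x ^ n / fact n)"
    using t(1) assms(1) by (intro mult_right_mono) auto
  then have "exp x * (1 - x ^ n / fact n) \<le> (\<Sum>m<n. x ^ m / fact m)"
    using t(2) unfolding right_diff_distrib by simp
  then show ?thesis using assms(2) by (simp add: pos_le_divide_eq)
qed

lemma exp_le_chord:
  assumes "a \<le> x" "x \<le> b" "a < b"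
  shows "exp x \<le> exp a + (exp b - exp a) / (b - a) * (x - (a::real))"
proof -
  have "convex_on {a..b} (exp :: real \<Rightarrow> real)"
    by (rule convex_on_subset[OF exp_convex]) auto
  from convex_onD_Icc'[OF this, of x] assms show ?thesis by (simp add: algebra_simps)
qed

lemma exp_half_le: "exp (1 / 2 :: real) \<le> 1.6488"
  using exp_upper_Taylor[of "1/2" 7] by (simp add: eval_nat_numeral)

lemma exp_one_le: "exp (1 :: real) \<le> 2.7183"
  using exp_upper_Taylor[of 1 10] by (simp add: eval_nat_numeral)

section \<open>The fixed points and the derivative of H2\<close>

lemma unique_crossing_of_decreasing:
  fixes f :: "real \<Rightarrow> real"
  assumes "a \<le> b" and cont: "continuous_on {a..b} f"
    and dec: "\<And>x y. a \<le> x \<Longrightarrow> x < y \<Longrightarrow> y \<le> b \<Longrightarrow> f y < f x"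
    and "a \<le> f a" "f b \<le> b"
  shows "\<exists>!x. x \<in> {a..b} \<and> f x = x"
proof -
  have "continuous_on {a..b} (\<lambda>x. x - f x)" by (intro continuous_intros cont)
  then obtain x where x: "a \<le> x" "x \<le> b" "x - f x = 0"
    using IVT'[of "\<lambda>x. x - f x" a 0 b] assms by auto
  show ?thesis
  proof (rule ex1I[of _ x])
    show "x \<in> {a..b} \<and> f x = x" using x by auto
    fix y assume "y \<in> {a..b} \<and> f y = y"
    then show "y = x" using x dec[of x y] dec[of y x] by (cases x y rule: linorder_cases) auto
  qed
qed

lemma F1_eq: "F1 l x = exp (- (l * x))"
  by (simp add: F1_def G_def)

lemma F1_decreasing: "0 < l \<Longrightarrow> x < y \<Longrightarrow> F1 l y < F1 l x"
  by (simp add: F1_eq)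

text \<open>
  This factorisation is the relation \<open>z = A * exp (A - l)\<close> between \<open>A = l * F1 l x\<close> and
  \<open>z = l * F2 l x\<close>.
\<close>

lemma F2_eq: "F2 l x = F1 l x * exp (l * (F1 l x - 1))"
  by (simp add: F2_def G_def F1_eq algebra_simps flip: exp_add)

lemma F2_decreasing: "0 < l \<Longrightarrow> x < y \<Longrightarrow> F2 l y < F2 l x"
  using F1_decreasing[of l x y] by (simp add: F2_def G_def mult_strict_left_mono)

lemma c1:
  assumes l: "0 < l"
  shows "0 < c1 l" "c1 l < 1" "F1 l (c1 l) = c1 l"
proof -
  have "\<exists>!x. x \<in> {0..1} \<and> F1 l x = x"
    using l by (intro unique_crossing_of_decreasing F1_decreasing)
      (auto simp: F1_eq intro!: continuous_intros)
  from theI'[OF this] have c: "c1 l \<in> {0..1} \<and> F1 l (c1 l) = c1 l" unfolding c1_def .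
  then show "F1 l (c1 l) = c1 l" by simp
  show "0 < c1 l" using c by (metis F1_eq exp_gt_zero)
  then show "c1 l < 1" using c l by (metis F1_eq exp_less_one_iff mult_pos_pos neg_less_0_iff_less)
qed

text \<open>
  At the right end point, \<open>F2 l (c1 l) = exp (- l)\<close>, which lies below \<open>c1 l = exp (- l * c1 l)\<close>.
\<close>

lemma c2:
  assumes l: "0 < l"
  shows "0 < c2 l" "c2 l < c1 l" "F2 l (c2 l) = c2 l"
proof -
  have less: "F2 l (c1 l) < c1 l"
  proof -
    have "F2 l (c1 l) = exp (- l)" using c1[OF l] by (simp add: F2_def G_def)
    also have "\<dots> < exp (- (l * c1 l))" using l c1[OF l] by simp
    finally show ?thesis using c1(3)[OF l] by (simp add: F1_eq)
  qed
  have "\<exists>!x. x \<in> {0..c1 l} \<and> F2 l x = x"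
    using l c1[OF l] less by (intro unique_crossing_of_decreasing F2_decreasing)
      (auto simp: F1_eq F2_eq intro!: continuous_intros)
  from theI'[OF this] have c: "c2 l \<in> {0..c1 l} \<and> F2 l (c2 l) = c2 l" unfolding c2_def .
  then show "F2 l (c2 l) = c2 l" by simp
  show "0 < c2 l" using c by (metis F2_def G_def exp_gt_zero)
  show "c2 l < c1 l" using c less by (cases "c2 l = c1 l") auto
qed

lemma c2_less_F2_iff: "0 < l \<Longrightarrow> x < c2 l \<longleftrightarrow> x < F2 l x"
  using F2_decreasing[of l x "c2 l"] F2_decreasing[of l "c2 l" x] c2(3)[of l]
  by (cases x "c2 l" rule: linorder_cases) auto

text \<open>
  The only factor of the derivative \<open>H2_slope\<close> of \<open>H2\<close> that can spoil its positivity; it is at least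
  1 for nonnegative \<open>x\<close>.
\<close>

definition slope_factor :: "real \<Rightarrow> real \<Rightarrow> real" where
  "slope_factor l x = (1 + l * F1 l x) * (1 - exp (l * (F1 l x - 1))) + 1"

definition H2_slope :: "real \<Rightarrow> real \<Rightarrow> real" where
  "H2_slope l x = l\<^sup>2 * H2 l x * (l * F2 l x) * exp (- (l * F2 l x)) * slope_factor l x"

lemma H2_eq: "H2 l x = exp (l * (exp (- (l * F2 l x)) * (1 - exp (l * (F1 l x - 1))) - 1))"
  by (simp add: H2_def G_def algebra_simps flip: exp_add)

lemma F1_deriv [derivative_intros]: "(F1 l has_real_derivative - (l * F1 l x)) (at x)"
  unfolding F1_eq[abs_def] by (auto intro!: derivative_eq_intros)

lemma F2_deriv: "(F2 l has_real_derivative - (l * F2 l x * (1 + l * F1 l x))) (at x)"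
  unfolding F2_eq[abs_def]
  by (auto intro!: derivative_eq_intros F1_deriv simp: algebra_simps)

lemma H2_deriv: "(H2 l has_real_derivative H2_slope l x) (at x)"
  unfolding H2_eq[abs_def] H2_slope_def H2_eq slope_factor_def
  by (auto intro!: derivative_eq_intros F1_deriv F2_deriv simp: F2_eq algebra_simps power2_eq_square)

lemma slope_factor_deriv:
  "(slope_factor l has_real_derivative
     l * ((1 + l * F1 l x) * (l * F2 l x) - l * F1 l x * (1 - exp (l * (F1 l x - 1))))) (at x)"
  unfolding slope_factor_def[abs_def]
  by (auto intro!: derivative_eq_intros F1_deriv simp: F2_eq algebra_simps power2_eq_square)

lemma F1_le_1: "0 < l \<Longrightarrow> 0 \<le> x \<Longrightarrow> F1 l x \<le> 1"
  by (simp add: F1_eq)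

lemma F1_pos: "0 < F1 l x" and F2_pos: "0 < F2 l x" and H2_pos: "0 < H2 l x"
  by (simp_all add: F1_eq F2_eq H2_eq)

lemma slope_factor_ge_1: "0 < l \<Longrightarrow> 0 \<le> x \<Longrightarrow> 1 \<le> slope_factor l x"
  using F1_le_1[of l x] F1_pos[of l x] by (simp add: slope_factor_def mult_nonneg_nonneg mult_nonneg_nonpos)

lemma H2_slope_pos: "0 < l \<Longrightarrow> 0 \<le> x \<Longrightarrow> 0 < H2_slope l x"
  using slope_factor_ge_1[of l x] F2_pos[of l x] H2_pos[of l x] by (simp add: H2_slope_def)

section \<open>Strict convexity of H2\<close>

text \<open>
  Write \<open>k = l * z * exp (- z)\<close>. For \<open>z \<ge> 1\<close> the left-hand side is not positive. For \<open>z\<close> between 1/2 and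
  1, \<open>k\<close> is at least a fixed multiple of \<open>1 + A\<close> and a quadratic in \<open>Y\<close> with negative discriminant
  decides. For \<open>z < 1/2\<close> the hypothesis \<open>l \<le> A * exp z\<close>, where \<open>l = A + ln (A / z)\<close>, becomes decisive:
  it prevents \<open>z\<close> from being small unless \<open>A\<close> is large, and yields \<open>A > 2\<close>, \<open>z \<ge> 1 / A\<close>
  and \<open>l > A + 1\<close>, which is enough to make \<open>k\<close> close to 1 or larger.
\<close>

lemma convexity_inequality:
  fixes A z l q Y :: real
  assumes l: "2 \<le> l" and A: "0 < A" "A < l" and z: "z = A * exp (A - l)"
    and below: "l \<le> A * exp z"
    and q: "q = 1 - z / A" and Y: "Y = (1 + A) * q + 1"
  shows "(1 + A) * (1 - z) < l * z * exp (- z) * Y + ((1 + A) * z - A * q) / Y"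
proof -
  have z0: "0 < z" using A z by simp
  have zA: "z / A = exp (A - l)" using A z by simp
  have q01: "0 < q" "q < 1" using A z0 by (auto simp: q zA)
  have Y1: "1 < Y" using q01 A by (simp add: Y)
  define k where "k = l * z * exp (- z)"
  have k0: "0 < k" using l z0 by (simp add: k_def)
  have suff: ?thesis if "(1 + A) * (1 - z) * Y < k * Y\<^sup>2 + ((1 + A) * z - A * q)"
  proof -
    have "(1 + A) * (1 - z) < (k * Y\<^sup>2 + ((1 + A) * z - A * q)) / Y"
      using that Y1 by (simp add: pos_less_divide_eq)
    also have "\<dots> = k * Y + ((1 + A) * z - A * q) / Y"
      using Y1 by (simp add: field_simps power2_eq_square)
    finally show ?thesis by (simp add: k_def)
  qed
  have Aq: "A * q = A * (Y - 1) / (1 + A)" using A by (simp add: Y)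
  have ratio: "exp (l - A) = A / z"
    using z0 A by (simp add: z exp_diff)
  consider "1 \<le> z" | "1 / 2 \<le> z" "z < 1" | "z < 1 / 2" by linarith
  then show ?thesis
  proof cases
    case 1
    have "A * q \<le> A" using q01 A by simp
    also have "A < 1 + A" by simp
    also have "\<dots> \<le> (1 + A) * z" using 1 A by simp
    finally have "0 < k * Y\<^sup>2 + ((1 + A) * z - A * q)" using k0 Y1 by (simp add: add_pos_pos)
    moreover have "(1 + A) * (1 - z) * Y \<le> 0"
      using 1 A Y1 by (simp add: mult_nonneg_nonpos mult_nonpos_nonneg)
    ultimately show ?thesis by (intro suff) linarith
  next
    case 2
    have "exp z \<le> exp (1/2) + (exp 1 - exp (1/2)) / (1 - 1/2) * (z - 1/2)"
      using 2 by (intro exp_le_chord) auto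
    also have "\<dots> = exp (1/2) * (1 - 2 * (z - 1/2)) + exp 1 * (2 * (z - 1/2))"
      by (simp add: algebra_simps)
    also have "\<dots> \<le> 1.6488 * (1 - 2 * (z - 1/2)) + 2.7183 * (2 * (z - 1/2))"
      using 2 exp_half_le exp_one_le by (intro add_mono mult_right_mono) auto
    finally have "0.303 * exp z \<le> z" using 2 by (simp add: field_simps)
    then have zez: "0.303 \<le> z * exp (- z)" by (simp add: exp_minus field_simps)
    \<comment> \<open>\<open>l \<ge> 2\<close> and \<open>l \<ge> A\<close> give \<open>3 * l \<ge> 2 * (1 + A)\<close>\<close>
    have "0.202 * (1 + A) \<le> l * 0.303" using l A by simp
    also have "\<dots> \<le> k" using zez l unfolding k_def mult.assoc by (intro mult_left_mono) auto
    finally have k: "0.202 * (1 + A) \<le> k" .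
    have "A * (Y - 1) / (1 + A) \<le> (1 + A) * ((Y - 1) / 4)"
    proof -
      have "0 \<le> (1 - A)\<^sup>2 * (Y - 1)" using Y1 by simp
      then show ?thesis using A by (simp add: field_simps power2_eq_square)
    qed
    moreover have "0.202 * (1 + A) * Y\<^sup>2 \<le> k * Y\<^sup>2" using k by (intro mult_right_mono) auto
    moreover have "(1 + A) * ((1 - z) * Y + (Y - 1) / 4 - z - 0.202 * Y\<^sup>2) < 0"
    proof -
      \<comment> \<open>completing the square, with room to spare\<close>
      have "0 < (Y - 0.75 / 0.404)\<^sup>2 * 0.202 + 0.01" by (simp add: add_nonneg_pos)
      then have "0 < 0.202 * Y\<^sup>2 - 0.75 * Y + 0.75" by (simp add: power2_eq_square algebra_simps)
      moreover have "(z - 1/2) * (Y + 1) \<ge> 0" using 2 Y1 by simp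
      ultimately have "(1 - z) * Y + (Y - 1) / 4 - z - 0.202 * Y\<^sup>2 < 0"
        by (simp add: field_simps)
      then show ?thesis using A by (simp add: mult_pos_neg)
    qed
    moreover have "(1 + A) * ((1 - z) * Y + (Y - 1) / 4 - z - 0.202 * Y\<^sup>2) =
        (1 + A) * (1 - z) * Y + (1 + A) * ((Y - 1) / 4) - (1 + A) * z - 0.202 * (1 + A) * Y\<^sup>2"
      by (simp only: right_diff_distrib distrib_left mult_ac)
    ultimately show ?thesis by (intro suff) (unfold Aq, linarith)
  next
    case 3
    have lA: "l - A \<le> A * (exp z - 1)" using below by (simp add: algebra_simps)
    have A2: "2 < A"
    proof (rule ccontr)
      assume "\<not> 2 < A"
      then have A2: "A \<le> 2" by simp
      have "exp z \<le> 1.6488" using exp_half_le 3 by (smt (verit) exp_le_cancel_iff)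
      then have le: "l \<le> A * 1.6488" using below A by (smt (verit) mult_left_mono)
      then have A12: "1.2 \<le> A" using l by simp
      \<comment> \<open>\<open>A / z\<close> exceeds \<open>2 * A\<close>, but \<open>exp (l - A)\<close> does not: by convexity it suffices to look at \<open>A = 1.2\<close> and \<open>A = 2\<close>\<close>
      have "2 * A < A / z" using 3 z0 A by (simp add: field_simps)
      also have "\<dots> = exp (l - A)" using ratio by simp
      also have "\<dots> \<le> exp (0.6488 * A)" using le by simp
      also have "\<dots> \<le> exp 0.77856 + (exp 1.2976 - exp 0.77856) / (1.2976 - 0.77856) * (0.6488 * A - 0.77856)"
        using A12 A2 by (intro exp_le_chord) auto
      also have "\<dots> = exp 0.77856 * (2.5 - 1.25 * A) + exp 1.2976 * (1.25 * A - 1.5)"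
        by (simp add: field_simps)
      also have "\<dots> \<le> 2.18 * (2.5 - 1.25 * A) + 3.661 * (1.25 * A - 1.5)"
      proof (intro add_mono mult_right_mono)
        show "exp (0.77856 :: real) \<le> 2.18"
          using exp_upper_Taylor[of "0.77856" 8] by (simp add: eval_nat_numeral)
        show "exp (1.2976 :: real) \<le> 3.661"
          using exp_upper_Taylor[of "1.2976" 12] by (simp add: eval_nat_numeral)
      qed (use A12 A2 in auto)
      finally show False using A12 by (simp add: field_simps)
    qed
    have zA1: "1 \<le> z * A"
    proof (rule ccontr)
      assume "\<not> 1 \<le> z * A"
      then have z1: "z < 1 / A" using A by (simp add: field_simps)
      have "exp z \<le> exp (1 / A)" using z1 by simp
      also have "\<dots> \<le> exp 0 + (exp (1/2) - exp 0) / (1/2 - 0) * (1 / A - 0)"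
        using A2 by (intro exp_le_chord) (auto simp: field_simps)
      also have "\<dots> \<le> 1 + 1.3 * (1 / A)"
      proof -
        have "(exp (1/2) - 1) * (2 / A) \<le> 0.65 * (2 / A)"
          using exp_half_le A by (intro mult_right_mono) auto
        then show ?thesis by simp
      qed
      finally have "A * (exp z - 1) \<le> 1.3" using A by (simp add: field_simps)
      with lA have "exp (l - A) \<le> exp 1.3" by simp
      also have "\<dots> < 4"
        using exp_upper_Taylor[of "1.3" 8] by (simp add: eval_nat_numeral)
      also have "4 < A * A" using mult_strict_mono[of 2 A 2 A] A2 by simp
      also have "\<dots> < A / z" using z1 z0 A by (simp add: field_simps)
      finally show False using ratio by simp
    qed
    have "z * exp 1 \<le> z * 4" using exp_one_le z0 by (intro mult_left_mono) auto
    also have "z * 4 < A" using 3 A2 by simp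
    finally have "exp 1 < A / z" using z0 by (simp add: pos_less_divide_eq mult.commute)
    then have "exp 1 < exp (l - A)" using ratio by simp
    then have l1: "A + 1 < l" by simp
    have "(A - 1) / A\<^sup>2 = (1 / A) * (1 - 1 / A)" using A by (simp add: field_simps power2_eq_square)
    also have "\<dots> \<le> z * (1 - z)"
    proof -
      have "1 / A \<le> z" using zA1 A by (simp add: field_simps)
      moreover have "1 / A \<le> 1/2" using A2 by simp
      ultimately have "0 \<le> (z - 1 / A) * (1 - z - 1 / A)" using 3 by (intro mult_nonneg_nonneg) auto
      then show ?thesis by (simp add: algebra_simps)
    qed
    also have "\<dots> \<le> z * exp (- z)"
      using z0 exp_ge_add_one_self[of "- z"] by (intro mult_left_mono) auto
    finally have zez: "(A - 1) / A\<^sup>2 \<le> z * exp (- z)" .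
    have "(A + 1) * ((A - 1) / A\<^sup>2) \<le> l * (z * exp (- z))"
      using zez l1 A2 by (intro mult_mono) auto
    then have k: "(A + 1) * ((A - 1) / A\<^sup>2) \<le> k" by (simp add: k_def)
    have q: "1 - 1 / (2 * A) \<le> q" using 3 A by (simp add: q field_simps)
    \<comment> \<open>the bounds on \<open>k\<close>, \<open>q\<close> and \<open>z\<close> leave a polynomial inequality in \<open>A\<close>, valid for \<open>A > 2\<close>\<close>
    have "1 + A / (1 + A)\<^sup>2 < (2 * A - 1) * (A\<^sup>2 + 2 * A - 1) / (2 * A ^ 3)"
    proof -
      have "0 < (A\<^sup>2 + 2 * A) * (A\<^sup>2 - 4) + (6 * A + 1)"
        using A2 mult_strict_mono[of 2 A 2 A] by (intro add_nonneg_pos mult_nonneg_nonneg) (auto simp: power2_eq_square)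
      then have "0 < A ^ 4 + 2 * A ^ 3 - 4 * A\<^sup>2 - 2 * A + 1"
        by (simp add: algebra_simps power2_eq_square power3_eq_cube power4_eq_xxxx)
      then have "A * (2 * A ^ 3) < ((3 * A - 1) * (A - 1)) * (1 + A)\<^sup>2"
        by (simp add: algebra_simps power2_eq_square power3_eq_cube power4_eq_xxxx)
      then have "A / (1 + A)\<^sup>2 < ((3 * A - 1) * (A - 1)) / (2 * A ^ 3)"
        using A by (simp add: divide_less_eq less_divide_eq)
      also have "\<dots> = (2 * A - 1) * (A\<^sup>2 + 2 * A - 1) / (2 * A ^ 3) - 1"
        using A by (simp add: field_simps power2_eq_square power3_eq_cube)
      finally show ?thesis by simp
    qed
    also have "\<dots> = (A + 1) * ((A - 1) / A\<^sup>2) * ((1 - 1 / (2 * A)) + 1 / (1 + A)) + 1 / A"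
    proof -
      have "(1 + A) * (u + 1 / (1 + A)) = (1 + A) * u + 1" for u
        using A by (simp add: distrib_left)
      from this[of "1 - 1 / (2 * A)"]
      have "(A + 1) * ((A - 1) / A\<^sup>2) * ((1 - 1 / (2 * A)) + 1 / (1 + A)) =
          (A - 1) / A\<^sup>2 * ((1 + A) * (1 - 1 / (2 * A)) + 1)"
        by (simp add: mult_ac add.commute)
      also have "(1 + A) * (1 - 1 / (2 * A)) + 1 = (2 * A\<^sup>2 + 3 * A - 1) / (2 * A)"
        using A by (simp add: field_simps power2_eq_square)
      also have "(A - 1) / A\<^sup>2 * ((2 * A\<^sup>2 + 3 * A - 1) / (2 * A)) + 1 / A
          = (2 * A - 1) * (A\<^sup>2 + 2 * A - 1) / (2 * A ^ 3)"
        using A by (simp add: field_simps power2_eq_square power3_eq_cube)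
      finally show ?thesis by simp
    qed
    also have "\<dots> \<le> k * (q + 1 / (1 + A)) + z"
    proof (intro add_mono mult_mono k q order.refl)
      show "1 / A \<le> z" using zA1 A by (simp add: field_simps)
      have "0 \<le> 1 - 1 / (2 * A)" using A2 by (simp add: field_simps)
      then show "0 \<le> 1 - 1 / (2 * A) + 1 / (1 + A)" using A2 by (intro add_nonneg_nonneg) auto
    qed (use k0 in simp)
    finally have main: "1 + A / (1 + A)\<^sup>2 < k * (q + 1 / (1 + A)) + z" .
    have "q + 1 / (1 + A) = Y / (1 + A)" using A by (simp add: Y field_simps)
    with main have "(1 + A) * (1 + A / (1 + A)\<^sup>2) < (1 + A) * (k * (Y / (1 + A)) + z)"
      using A by (intro mult_strict_left_mono) auto
    also have "(1 + A) * (1 + A / (1 + A)\<^sup>2) = (1 + A) + A / (1 + A)"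
      using A by (simp only: distrib_left) (simp add: power2_eq_square)
    also have "(1 + A) * (k * (Y / (1 + A)) + z) = k * Y + (1 + A) * z"
      using A by (simp only: distrib_left) simp
    finally have "(1 + A) + A / (1 + A) < k * Y + (1 + A) * z" .
    then have "((1 + A) + A / (1 + A)) * Y < (k * Y + (1 + A) * z) * Y"
      using Y1 by (intro mult_strict_right_mono) auto
    moreover have "A * (Y - 1) / (1 + A) \<le> A / (1 + A) * Y"
      using A Y1 by (simp add: field_simps)
    moreover have "0 < (1 + A) * z" using A z0 by simp
    ultimately show ?thesis
      by (intro suff) (simp add: Aq algebra_simps power2_eq_square)
  qed
qed

text \<open>
  Logarithmic differentiation of \<open>H2_slope\<close>. The sign of the second derivative is that of the last
  factor, which is the difference of the two sides of \<open>convexity_inequality\<close>.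
\<close>

lemma H2_slope_deriv:
  assumes "0 < l" "0 \<le> x"
  defines "A \<equiv> l * F1 l x" and "z \<equiv> l * F2 l x" and "q \<equiv> 1 - exp (l * (F1 l x - 1))"
  shows "(H2_slope l has_real_derivative
    l * H2_slope l x * (l * z * exp (- z) * slope_factor l x + ((1 + A) * z - A * q) / slope_factor l x - (1 + A) * (1 - z))) (at x)"
proof -
  have Y: "slope_factor l x \<noteq> 0" using slope_factor_ge_1[OF assms(1,2)] by simp
  show ?thesis
    unfolding H2_slope_def[abs_def]
    apply (rule derivative_eq_intros H2_deriv F2_deriv slope_factor_deriv refl)+
    unfolding A_def z_def q_def H2_slope_def using Y
    by (simp add: field_simps power2_eq_square)
qed

text \<open>
  Left of \<open>c2 l\<close> the graph of \<open>F2 l\<close> is above the diagonal, so \<open>l * x \<le> z\<close>, and \<open>l = A * exp (l * x)\<close>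
  gives the hypothesis of \<open>convexity_inequality\<close> that ties \<open>z\<close> to \<open>A\<close>. The end point \<open>c2 l\<close> is included
  because the comparison of \<open>H2 l\<close> with its tangent there uses it.
\<close>

lemma H2_slope_deriv_pos:
  assumes l: "2 \<le> l" and x: "0 < x" "x \<le> c2 l"
  shows "\<exists>D>0. (H2_slope l has_real_derivative D) (at x)"
proof -
  define A where "A = l * F1 l x"
  define z where "z = l * F2 l x"
  define q where "q = 1 - exp (l * (F1 l x - 1))"
  have F1: "F1 l x < 1" "0 < F1 l x" using l x by (simp_all add: F1_eq)
  have "l * x \<le> z" using c2_less_F2_iff[of l x] c2(3)[of l] l x by (cases "x = c2 l") (simp_all add: z_def)
  have ex: "exp (A - l) = exp (l * (F1 l x - 1))" by (simp add: A_def algebra_simps)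
  have z: "z = A * exp (A - l)" unfolding ex by (simp add: z_def A_def F2_eq)
  have "A * exp z \<ge> A * exp (l * x)" using \<open>l * x \<le> z\<close> F1 l by (simp add: A_def)
  moreover have "A * exp (l * x) = l" by (simp add: A_def F1_eq flip: exp_add)
  ultimately have below: "l \<le> A * exp z" by simp
  have "(1 + A) * (1 - z) < l * z * exp (- z) * slope_factor l x + ((1 + A) * z - A * q) / slope_factor l x"
  proof (rule convexity_inequality[OF l])
    show "0 < A" "A < l" using F1 l by (simp_all add: A_def)
    then show "q = 1 - z / A" by (simp add: z q_def ex)
    show "slope_factor l x = (1 + A) * q + 1" by (simp add: slope_factor_def A_def q_def)
  qed (fact z below)+
  then show ?thesis
    using H2_slope_deriv[of l x] H2_slope_pos[of l x] l x
    unfolding A_def z_def q_def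
    by (intro exI conjI) (auto intro!: mult_pos_pos)
qed

lemma strict_convex_on_if_deriv_increasing:
  fixes f :: "real \<Rightarrow> real"
  assumes f: "\<And>x. x \<in> {a..b} \<Longrightarrow> (f has_real_derivative f' x) (at x)"
    and mono: "\<And>x y. a < x \<Longrightarrow> x < y \<Longrightarrow> y < b \<Longrightarrow> f' x < f' y"
  shows "strict_convex_on {a..b} f"
proof -
  have chord: "f ((1 - t) * x + t * y) < (1 - t) * f x + t * f y"
    if xy: "a \<le> x" "x < y" "y \<le> b" and t: "0 < t" "t < 1" for x y t
  proof -
    define m where "m = (1 - t) * x + t * y"
    have mx: "m - x = t * (y - x)" and ym: "y - m = (1 - t) * (y - x)"
      by (simp_all add: m_def algebra_simps)
    have "x < m" "m < y" using xy t mx ym by (smt (verit) mult_pos_pos)+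
    obtain u where u: "x < u" "u < m" "f m - f x = (m - x) * f' u"
      using MVT2[OF \<open>x < m\<close>, of f f'] f xy \<open>m < y\<close> by force
    obtain v where v: "m < v" "v < y" "f y - f m = (y - m) * f' v"
      using MVT2[OF \<open>m < y\<close>, of f f'] f xy \<open>x < m\<close> by force
    have "f' u < f' v" using mono u v xy by simp
    then have "(y - x) * (t * (1 - t)) * f' u < (y - x) * (t * (1 - t)) * f' v"
      using xy t by simp
    then have "(1 - t) * (f m - f x) < t * (f y - f m)"
      by (simp add: u v mx ym algebra_simps)
    then show ?thesis unfolding m_def[symmetric] by (simp add: algebra_simps)
  qed
  have "f ((1 - t) * x + t * y) < (1 - t) * f x + t * f y"
    if "x \<in> {a..b}" "y \<in> {a..b}" "x \<noteq> y" "0 < t" "t < 1" for x y t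
    using that chord[of x y t] chord[of y x "1 - t"]
    by (cases x y rule: linorder_cases) (auto simp: add.commute)
  then show ?thesis unfolding strict_convex_on_def by auto
qed

lemma H2_slope_less:
  assumes l: "2 \<le> l" and "0 < x" "x < y" "y \<le> c2 l"
  shows "H2_slope l x < H2_slope l y"
proof (rule DERIV_pos_imp_increasing[OF \<open>x < y\<close>])
  fix u assume "x \<le> u" "u \<le> y"
  then obtain D where "D > 0" "(H2_slope l has_real_derivative D) (at u)"
    using H2_slope_deriv_pos[OF l, of u] assms by auto
  then show "\<exists>D. (H2_slope l has_real_derivative D) (at u) \<and> D > 0" by blast
qed

theorem H2_strict_convex:
  assumes l: "2 \<le> l"
  shows "strict_convex_on {0..c2 l} (H2 l)"
proof (rule strict_convex_on_if_deriv_increasing)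
  show "(H2 l has_real_derivative H2_slope l x) (at x)" for x by (rule H2_deriv)
  show "H2_slope l x < H2_slope l y" if "0 < x" "x < y" "y < c2 l" for x y
    using that by (intro H2_slope_less[OF l]) auto
qed

section \<open>Growth of the slope at the fixed point\<close>

text \<open>
  The values of \<open>l * x\<close> (equivalently \<open>l * F2 l x\<close>) and \<open>l * F1 l x\<close> at \<open>x = c2 l\<close>.
\<close>

definition t2 :: "real \<Rightarrow> real" where "t2 l = l * c2 l"

definition A2 :: "real \<Rightarrow> real" where "A2 l = l * exp (- t2 l)"

lemma t2_pos: "0 < l \<Longrightarrow> 0 < t2 l" and A2_pos: "0 < l \<Longrightarrow> 0 < A2 l"
  using c2(1) by (simp_all add: t2_def A2_def)

lemma t2_eq: "0 < l \<Longrightarrow> t2 l = A2 l * exp (A2 l - l)"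
  using c2(3)[of l] by (simp add: t2_def A2_def F2_eq F1_eq algebra_simps)

lemma H2_c2:
  assumes "0 < l"
  shows "H2 l (c2 l) = c2 l"
  using c2(3)[OF assms] by (simp add: H2_def) (simp add: F1_def F2_def G_def algebra_simps)

lemma H2_slope_c2:
  assumes l: "0 < l"
  shows "H2_slope l (c2 l) = (t2 l)\<^sup>2 * ((A2 l)\<^sup>2 + 2 * A2 l - t2 l * (1 + A2 l))"
proof -
  define A where "A = A2 l"
  define t where "t = t2 l"
  have A: "l * F1 l (c2 l) = A" by (simp add: A_def A2_def t2_def F1_eq)
  have t: "l * c2 l = t" by (simp add: t_def t2_def)
  have h: "A * exp (l * (F1 l (c2 l) - 1)) = t"
    using t2_eq[OF l] A by (simp add: t_def A_def algebra_simps)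
  have a: "l * exp (- t) = A" by (simp add: A_def A2_def t_def)
  have "A * slope_factor l (c2 l) = (1 + A) * (A - A * exp (l * (F1 l (c2 l) - 1))) + A"
    by (simp add: slope_factor_def A algebra_simps)
  then have Y: "A * slope_factor l (c2 l) = (1 + A) * (A - t) + A" unfolding h .
  have "H2_slope l (c2 l) = (l * c2 l) * (l * c2 l) * ((l * exp (- (l * c2 l))) * slope_factor l (c2 l))"
    by (simp add: H2_slope_def H2_c2[OF l] c2[OF l] power2_eq_square)
  also have "\<dots> = t * t * (A * slope_factor l (c2 l))" by (simp add: t a)
  also have "\<dots> = t\<^sup>2 * (A\<^sup>2 + 2 * A - t * (1 + A))"
    unfolding Y by (simp add: power2_eq_square algebra_simps)
  finally show ?thesis by (simp add: A_def t_def)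
qed

text \<open>
  With \<open>t = t2 l\<close>, \<open>A = A2 l\<close> and \<open>e = exp t - 1\<close> the fixed point equation reads \<open>t * e = (A * e) * exp (- (A * e))\<close>, and
  \<open>y * exp (- y)\<close> never exceeds \<open>exp (- 1)\<close>. So \<open>t\<close> is bounded uniformly in \<open>l\<close>.
\<close>

lemma t2_less:
  assumes l: "0 < l"
  shows "t2 l < 0.55"
proof (rule ccontr)
  assume "\<not> t2 l < 0.55"
  then have t: "0.55 \<le> t2 l" by simp
  define e where "e = exp (t2 l) - 1"
  have lA: "l = A2 l * exp (t2 l)" by (simp add: A2_def flip: exp_add)
  have "t2 l + (t2 l)\<^sup>2 / 2 \<le> e"
    using exp_lower_Taylor[of "t2 l" 3] t by (simp add: e_def eval_nat_numeral)
  moreover have "0.55 * 0.55 \<le> (t2 l)\<^sup>2"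
    using t unfolding power2_eq_square by (intro mult_mono) auto
  ultimately have e: "0.70125 \<le> e" using t by simp
  have "t2 l * e = (A2 l * e) * exp (- (A2 l * e))"
    using t2_eq[OF l] lA by (simp add: e_def algebra_simps)
  also have "\<dots> \<le> exp (A2 l * e - 1) * exp (- (A2 l * e))"
    using exp_ge_add_one_self[of "A2 l * e - 1"] by (intro mult_right_mono) auto
  also have "\<dots> = 1 / exp 1" by (simp add: exp_minus field_simps flip: exp_add)
  also have "\<dots> \<le> 1 / 2.7"
    using exp_lower_Taylor[of 1 5] by (intro divide_left_mono) (auto simp: eval_nat_numeral)
  finally have "t2 l * e \<le> 1 / 2.7" .
  moreover have "0.55 * 0.70125 \<le> t2 l * e" using t e by (intro mult_mono) auto
  ultimately show False by simp
qed

lemma A2_ge: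
  assumes "1 \<le> l"
  shows "0.57 \<le> A2 l"
proof -
  have "exp (t2 l) \<le> exp 0.55" using t2_less[of l] assms by simp
  also have "\<dots> \<le> 1.75" using exp_upper_Taylor[of "0.55" 5] by (simp add: eval_nat_numeral)
  finally have "exp (t2 l) \<le> 1.75" .
  then have "0.57 * exp (t2 l) \<le> l" using assms by simp
  then show ?thesis by (simp add: A2_def exp_minus field_simps)
qed

text \<open>
  For \<open>t = t2 l\<close> the logarithm of the fixed point equation is \<open>ln t + t - l * exp (- t) = ln l - l\<close>. Subtracting the
  equations for \<open>l\<close> and \<open>l'\<close> and applying the mean value theorem to the left-hand side in \<open>t\<close> gives an
  exact formula for the increment of \<open>t2\<close>.
\<close>

lemma t2_increment:
  assumes l: "0 < l" and l': "0 < l'"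
  shows "\<exists>x>0. \<bar>x - t2 l\<bar> \<le> \<bar>t2 l' - t2 l\<bar> \<and>
     (t2 l' - t2 l) * (1 / x + 1 + l' * exp (- x)) = ln l' - ln l - (l' - l) * (1 - exp (- t2 l))"
proof -
  define g where "g x = ln x + x - l' * exp (- x)" for x
  have log: "ln (t2 m) = ln m - t2 m + m * exp (- t2 m) - m" if m: "0 < m" for m
  proof -
    have "ln (t2 m) = ln (A2 m) + (A2 m - m)"
      using t2_eq[OF m] A2_pos[OF m] by (metis exp_gt_zero ln_exp ln_mult_pos)
    also have "ln (A2 m) = ln m - t2 m" using m by (simp add: A2_def ln_mult)
    finally show ?thesis by (simp add: A2_def)
  qed
  have "g (t2 l') - g (t2 l) = ln l' - ln l - (l' - l) * (1 - exp (- t2 l))"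
    using log[OF l] log[OF l'] by (simp add: g_def algebra_simps)
  moreover have "\<exists>x>0. \<bar>x - t2 l\<bar> \<le> \<bar>t2 l' - t2 l\<bar> \<and>
      g (t2 l') - g (t2 l) = (t2 l' - t2 l) * (1 / x + 1 + l' * exp (- x))"
  proof -
    have d: "(g has_real_derivative (1 / x + 1 + l' * exp (- x))) (at x)" if "0 < x" for x
      unfolding g_def using that by (auto intro!: derivative_eq_intros)
    show ?thesis
    proof (cases "t2 l" "t2 l'" rule: linorder_cases)
      case less
      then obtain x where "t2 l < x" "x < t2 l'"
        "g (t2 l') - g (t2 l) = (t2 l' - t2 l) * (1 / x + 1 + l' * exp (- x))"
        using MVT2[OF less, of g "\<lambda>x. 1 / x + 1 + l' * exp (- x)"] d t2_pos[OF l] by force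
      then show ?thesis using t2_pos[OF l] by (intro exI[of _ x]) auto
    next
      case equal
      then show ?thesis using t2_pos[OF l] by (intro exI[of _ "t2 l"]) auto
    next
      case greater
      then obtain x where "t2 l' < x" "x < t2 l"
        "g (t2 l) - g (t2 l') = (t2 l - t2 l') * (1 / x + 1 + l' * exp (- x))"
        using MVT2[OF greater, of g "\<lambda>x. 1 / x + 1 + l' * exp (- x)"] d t2_pos[OF l'] by force
      then show ?thesis using t2_pos[OF l'] by (intro exI[of _ x]) (auto simp: algebra_simps)
    qed
  qed
  ultimately show ?thesis by metis
qed

text \<open>
  Implicit differentiation by hand: the factor of the increment in \<open>t2_increment\<close> is at least 1, hence
  \<open>t2\<close> is continuous, hence the intermediate point converges to \<open>t2 l\<close>.
\<close>

lemma t2_deriv: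
  assumes l: "0 < l"
  shows "(t2 has_real_derivative (1 / l - (1 - exp (- t2 l))) / (1 / t2 l + 1 + A2 l)) (at l)"
proof -
  define r where "r l' = ln l' - ln l - (l' - l) * (1 - exp (- t2 l))" for l'
  have "\<forall>l'. \<exists>x. 0 < l' \<longrightarrow> 0 < x \<and> \<bar>x - t2 l\<bar> \<le> \<bar>t2 l' - t2 l\<bar> \<and>
     (t2 l' - t2 l) * (1 / x + 1 + l' * exp (- x)) = r l'"
    using t2_increment[OF l] unfolding r_def by blast
  then obtain x where x: "\<And>l'. 0 < l' \<Longrightarrow> 0 < x l'"
    "\<And>l'. 0 < l' \<Longrightarrow> \<bar>x l' - t2 l\<bar> \<le> \<bar>t2 l' - t2 l\<bar>"
    "\<And>l'. 0 < l' \<Longrightarrow> (t2 l' - t2 l) * (1 / x l' + 1 + l' * exp (- x l')) = r l'"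
    by metis
  have pos: "\<forall>\<^sub>F l' in at l. 0 < l'"
    using l by (intro order_tendstoD(1)[OF tendsto_ident_at])
  have coeff: "1 \<le> 1 / x l' + 1 + l' * exp (- x l')" if "0 < l'" for l'
    using x(1)[OF that] that by simp
  have close: "\<bar>x l' - t2 l\<bar> \<le> \<bar>r l'\<bar>" if "0 < l'" for l'
  proof -
    have "\<bar>t2 l' - t2 l\<bar> * 1 \<le> \<bar>t2 l' - t2 l\<bar> * \<bar>1 / x l' + 1 + l' * exp (- x l')\<bar>"
      using coeff[OF that] by (intro mult_left_mono) auto
    also have "\<dots> = \<bar>r l'\<bar>" using x(3)[OF that] by (simp flip: abs_mult)
    finally show ?thesis using x(2)[OF that] by simp
  qed
  have "(r \<longlongrightarrow> r l) (at l)" unfolding r_def using l by (intro tendsto_intros) auto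
  then have "(r \<longlongrightarrow> 0) (at l)" by (simp add: r_def)
  then have "((\<lambda>l'. \<bar>r l'\<bar>) \<longlongrightarrow> 0) (at l)" by (simp add: tendsto_rabs_zero_iff)
  then have "((\<lambda>l'. x l' - t2 l) \<longlongrightarrow> 0) (at l)"
    by (rule Lim_null_comparison[rotated]) (use pos close in \<open>auto elim!: eventually_mono\<close>)
  then have xlim: "(x \<longlongrightarrow> t2 l) (at l)" by (simp add: LIM_zero_iff)
  have "(r has_real_derivative 1 / l - (1 - exp (- t2 l))) (at l)"
    unfolding r_def using l by (auto intro!: derivative_eq_intros)
  then have "((\<lambda>l'. (r l' - r l) / (l' - l)) \<longlongrightarrow> 1 / l - (1 - exp (- t2 l))) (at l)"
    by (simp add: has_field_derivative_iff)
  then have "((\<lambda>l'. (r l' - r l) / (l' - l) / (1 / x l' + 1 + l' * exp (- x l'))) \<longlongrightarrow>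
      (1 / l - (1 - exp (- t2 l))) / (1 / t2 l + 1 + l * exp (- t2 l))) (at l)"
    using t2_pos[OF l] l
    by (intro tendsto_intros xlim) (auto simp: add_pos_pos less_imp_neq[symmetric])
  moreover have "\<forall>\<^sub>F l' in at l. (r l' - r l) / (l' - l) / (1 / x l' + 1 + l' * exp (- x l'))
      = (t2 l' - t2 l) / (l' - l)"
    using pos
  proof eventually_elim
    case (elim l')
    have "1 / x l' + 1 + l' * exp (- x l') \<noteq> 0" using coeff[OF elim] by linarith
    moreover have "r l' - r l = (t2 l' - t2 l) * (1 / x l' + 1 + l' * exp (- x l'))"
      using x(3)[OF elim] by (simp add: r_def)
    ultimately show ?case by simp
  qed
  ultimately show ?thesis
    unfolding has_field_derivative_iff A2_def by (rule Lim_transform_eventually)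
qed

text \<open>
  After replacing \<open>exp t - 1\<close> by its cubic majorant \<open>p\<close> and ordering by powers of \<open>A\<close>, the coefficients of
  \<open>A ^ 3\<close> and \<open>A\<^sup>2\<close> are nonnegative, and the linear term beats the constant \<open>- 3 * t\<close>.
\<close>

lemma slope_growth_inequality:
  fixes t A :: real
  assumes t: "0 < t" "t \<le> 0.55" and A: "0.57 \<le> A"
  shows "0 < (1 - A * (exp t - 1)) * (2 * A\<^sup>2 * (1 - t) + A * (4 - 5 * t + t\<^sup>2) - 3 * t)
     + (1 + t + t * A) * (A * (2 * A + 2 - t))"
proof -
  define e where "e = exp t - 1"
  define p where "p = t + t\<^sup>2 / 2 + 0.3 * t ^ 3"
  have tt: "t\<^sup>2 \<le> 0.55 * t" using t by (simp add: power2_eq_square)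
  have t2: "t\<^sup>2 \<le> 0.3025" using tt t by simp
  have t3: "t ^ 3 \<le> 0.17" "0 \<le> t ^ 3"
  proof -
    have "t ^ 3 = t\<^sup>2 * t" by (simp add: power2_eq_square power3_eq_cube)
    also have "\<dots> \<le> 0.3025 * 0.55" using t t2 by (intro mult_mono) auto
    finally show "t ^ 3 \<le> 0.17" by simp
  qed (use t in simp)
  have e: "0 \<le> e" "e \<le> p"
  proof -
    show "0 \<le> e" using t by (simp add: e_def)
    have "exp t \<le> (\<Sum>m<3. t ^ m / fact m) / (1 - t ^ 3 / fact 3)"
      using t t3 by (intro exp_upper_Taylor) (auto simp: eval_nat_numeral)
    also have "(\<Sum>m<3. t ^ m / fact m) = 1 + t + t\<^sup>2 / 2" by (simp add: eval_nat_numeral)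
    also have "(1 + t + t\<^sup>2 / 2) / (1 - t ^ 3 / fact 3) \<le> 1 + p"
    proof -
      have "(1 + p) * t ^ 3 \<le> 1.8 * t ^ 3"
        using t t2 t3 by (intro mult_right_mono) (auto simp: p_def)
      then have "1 + t + t\<^sup>2 / 2 \<le> (1 + p) * (1 - t ^ 3 / 6)"
        by (simp add: p_def algebra_simps)
      then show ?thesis using t3 by (simp add: pos_divide_le_eq fact_numeral)
    qed
    finally show "e \<le> p" by (simp add: e_def)
  qed
  have q: "0 \<le> 4 - 5 * t + t\<^sup>2" "4 - 5 * t + t\<^sup>2 \<le> 4"
    using t tt by auto
  define X where "X = 2 * A\<^sup>2 * (1 - t) + A * (4 - 5 * t + t\<^sup>2)"
  have X: "0 \<le> X" using A t q by (simp add: X_def)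
  have "0 < A ^ 3 * (t\<^sup>2 + 0.4 * t ^ 3 + 0.6 * t ^ 4)
      + A\<^sup>2 * (4 + 2 * t - t\<^sup>2 - p * (4 - 5 * t + t\<^sup>2)) + (A * (6 - 4 * t) - 3 * t)"
  proof (intro add_nonneg_pos add_nonneg_nonneg mult_nonneg_nonneg)
    have "p * (4 - 5 * t + t\<^sup>2) \<le> 0.8 * 4"
      using t t2 t3 q by (intro mult_mono) (auto simp: p_def)
    then show "0 \<le> 4 + 2 * t - t\<^sup>2 - p * (4 - 5 * t + t\<^sup>2)" using t t2 by simp
    have "0.57 * (6 - 4 * t) \<le> A * (6 - 4 * t)" using A t by (intro mult_right_mono) auto
    then show "0 < A * (6 - 4 * t) - 3 * t" using t by simp
  qed (use A t in auto)
  also have "t\<^sup>2 + 0.4 * t ^ 3 + 0.6 * t ^ 4 = 2 * t - 2 * p * (1 - t)"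
    by (simp add: p_def field_simps power2_eq_square power3_eq_cube power4_eq_xxxx)
  also have "A ^ 3 * (2 * t - 2 * p * (1 - t))
      + A\<^sup>2 * (4 + 2 * t - t\<^sup>2 - p * (4 - 5 * t + t\<^sup>2)) + (A * (6 - 4 * t) - 3 * t)
      = (1 - A * p) * X - 3 * t + (1 + t + t * A) * (A * (2 * A + 2 - t))"
    by (simp add: X_def algebra_simps power2_eq_square power3_eq_cube)
  also have "\<dots> \<le> (1 - A * e) * X - (1 - A * e) * (3 * t) + (1 + t + t * A) * (A * (2 * A + 2 - t))"
  proof -
    have "(1 - A * p) * X \<le> (1 - A * e) * X"
      using A e X by (intro mult_right_mono) auto
    moreover have "0 \<le> A * e * (3 * t)" using A e t by simp
    ultimately show ?thesis by (simp add: left_diff_distrib)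
  qed
  finally show ?thesis by (simp add: X_def e_def right_diff_distrib)
qed

text \<open>
  In terms of the logarithmic derivative \<open>M\<close> of \<open>t2\<close> (with respect to \<open>ln l\<close>) the derivative of the slope is
  \<open>t\<^sup>2 / l * (M * K + A * (2 * A + 2 - t))\<close>; clearing the denominator \<open>W\<close> of \<open>M\<close> and inserting
  \<open>l = A * exp t\<close> yields the expression of \<open>slope_growth_inequality\<close>.
\<close>

lemma slope_c2_deriv_pos:
  assumes l: "1 \<le> l"
  shows "\<exists>D>0. ((\<lambda>l. (t2 l)\<^sup>2 * ((A2 l)\<^sup>2 + 2 * A2 l - t2 l * (1 + A2 l))) has_real_derivative D) (at l)"
proof -
  define t where "t = t2 l"
  define A where "A = A2 l"
  define W where "W = 1 + t + t * A"
  define M where "M = (1 - l + A) / W"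
  have pos: "0 < l" "0 < t" "0 < A" "0 < W"
    using l t2_pos[of l] A2_pos[of l] by (auto simp: t_def A_def W_def add_pos_pos)
  have Al: "A = l * exp (- t)" by (simp add: A_def A2_def t_def)
  have T: "(t2 has_real_derivative t * M / l) (at l)"
  proof -
    have "(1 / l - (1 - exp (- t))) / (1 / t + 1 + A) = t * M / l"
    proof -
      have "1 / l - (1 - exp (- t)) = (1 - l + A) / l" using pos by (simp add: Al field_simps)
      moreover have "1 / t + 1 + A = W / t" using pos by (simp add: W_def field_simps)
      ultimately show ?thesis by (simp add: M_def mult_ac)
    qed
    then show ?thesis using t2_deriv[OF pos(1)] by (simp add: t_def A_def)
  qed
  have "(A2 has_real_derivative (exp (- t) - l * (exp (- t) * (t * M / l)))) (at l)"
    unfolding A2_def[abs_def]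
    by (rule derivative_eq_intros T refl)+ (simp add: t_def)
  moreover have "exp (- t) - l * (exp (- t) * (t * M / l)) = A * (1 - t * M) / l"
    using pos by (simp add: Al field_simps)
  ultimately have A: "(A2 has_real_derivative A * (1 - t * M) / l) (at l)" by simp
  define K where "K = 2 * A\<^sup>2 * (1 - t) + A * (4 - 5 * t + t\<^sup>2) - 3 * t"
  have "((\<lambda>l. (t2 l)\<^sup>2 * ((A2 l)\<^sup>2 + 2 * A2 l - t2 l * (1 + A2 l))) has_real_derivative
      t\<^sup>2 / l * (M * K + A * (2 * A + 2 - t))) (at l)"
    apply (rule derivative_eq_intros T A refl)+
    unfolding t_def[symmetric] A_def[symmetric] K_def
    by (simp add: add_divide_distrib diff_divide_distrib algebra_simps power2_eq_square)
  moreover have "0 < t\<^sup>2 / l * (M * K + A * (2 * A + 2 - t))"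
  proof -
    have "l = A * exp t" by (simp add: Al flip: exp_add)
    then have eq: "1 - l + A = 1 - A * (exp t - 1)" by (simp add: algebra_simps)
    have "0 < (1 - l + A) * K + W * (A * (2 * A + 2 - t))"
      unfolding eq K_def W_def
      using A2_ge[OF l] t2_less[of l] pos
      by (intro slope_growth_inequality) (simp_all add: t_def A_def)
    also have "\<dots> = W * (M * K + A * (2 * A + 2 - t))"
      using pos by (simp add: M_def distrib_left)
    finally show ?thesis using pos by (simp add: zero_less_mult_iff)
  qed
  ultimately show ?thesis by blast
qed

theorem slope_c2_strict_mono: "strict_mono_on {1..} (\<lambda>l. H2_slope l (c2 l))"
proof (rule strict_mono_onI)
  fix r s :: real assume rs: "r \<in> {1..}" "s \<in> {1..}" "r < s"
  let ?S = "\<lambda>l. (t2 l)\<^sup>2 * ((A2 l)\<^sup>2 + 2 * A2 l - t2 l * (1 + A2 l))"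
  have "?S r < ?S s"
  proof (rule DERIV_pos_imp_increasing[OF rs(3)])
    fix x assume "r \<le> x" "x \<le> s"
    then have "1 \<le> x" using rs by simp
    from slope_c2_deriv_pos[OF this]
    show "\<exists>D. (?S has_real_derivative D) (at x) \<and> 0 < D" by blast
  qed
  then show "H2_slope r (c2 r) < H2_slope s (c2 s)"
    using rs by (simp add: H2_slope_c2)
qed

section \<open>The slope at 2.406 and at 2.414\<close>

text \<open>
  The point \<open>s / l\<close> lies below \<open>c2 l\<close> iff it lies below its image under the decreasing function \<open>F2 l\<close>.
\<close>

lemma less_t2I:
  assumes l: "0 < l" and s: "0 < s" and "exp (s + l - l * exp (- s)) < l / s"
  shows "s < t2 l"
proof -
  have "F2 l (s / l) = 1 / exp (s + l - l * exp (- s))"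
    using l by (simp add: F2_eq F1_eq algebra_simps flip: exp_add exp_minus inverse_eq_divide)
  also have "\<dots> > s / l" using assms by (simp add: field_simps)
  finally have "s / l < F2 l (s / l)" .
  then have "s / l < c2 l" using c2_less_F2_iff[OF l] by simp
  then show ?thesis using l by (simp add: t2_def field_simps)
qed

lemma t2_lessI:
  assumes l: "0 < l" and s: "0 < s" and "l / s < exp (s + l - l * exp (- s))"
  shows "t2 l < s"
proof -
  have "F2 l (s / l) = 1 / exp (s + l - l * exp (- s))"
    using l by (simp add: F2_eq F1_eq algebra_simps flip: exp_add exp_minus inverse_eq_divide)
  also have "\<dots> < s / l" using assms by (simp add: field_simps)
  finally have *: "F2 l (s / l) < s / l" .
  then have "\<not> s / l < c2 l" using c2_less_F2_iff[OF l, of "s / l"] by simp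
  moreover have "s / l \<noteq> c2 l" using * c2(3)[OF l] by auto
  ultimately have "c2 l < s / l" by simp
  then show ?thesis using l by (simp add: t2_def field_simps)
qed

lemma exp_5283: "1.696 \<le> exp (0.5283 :: real)" "exp (0.5283 :: real) \<le> 1.6961"
  using exp_lower_Taylor[of "0.5283" 8] exp_upper_Taylor[of "0.5283" 8]
  by (simp_all add: eval_nat_numeral)

lemma exp_5285: "1.6963 \<le> exp (0.5285 :: real)" "exp (0.5285 :: real) \<le> 1.6964"
  using exp_lower_Taylor[of "0.5285" 8] exp_upper_Taylor[of "0.5285" 8]
  by (simp_all add: eval_nat_numeral)

text \<open>
  Here \<open>u\<close> is a rounded value of the exponent in \<open>less_t2I\<close>, so that only exponentials of explicit
  decimals need bounds. As a function of \<open>l\<close>, \<open>t2 l\<close> is almost stationary near 2.41, so the same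
  bounds 0.5283 and 0.5285 serve both parameters.
\<close>

lemma t2_lower:
  assumes l: "0 < l" and u: "0.5283 + l - l / 1.6961 \<le> u" and e: "exp u < l / 0.5283"
  shows "0.5283 < t2 l"
proof (rule less_t2I[OF l])
  have "1 / 1.6961 \<le> exp (- 0.5283 :: real)"
    using exp_5283 by (simp add: exp_minus field_simps)
  then have "l * (1 / 1.6961) \<le> l * exp (- 0.5283)" using l by (intro mult_left_mono) auto
  then have "exp (0.5283 + l - l * exp (- 0.5283)) \<le> exp u" using u by simp
  then show "exp (0.5283 + l - l * exp (- 0.5283)) < l / 0.5283" using e by linarith
qed simp

lemma t2_upper:
  assumes l: "0 < l" and u: "u \<le> 0.5285 + l - l / 1.6963" and e: "l / 0.5285 < exp u"
  shows "t2 l < 0.5285"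
proof (rule t2_lessI[OF l])
  have "exp (- 0.5285 :: real) \<le> 1 / 1.6963"
    using exp_5285 by (simp add: exp_minus field_simps)
  then have "l * exp (- 0.5285) \<le> l * (1 / 1.6963)" using l by (intro mult_left_mono) auto
  then have "exp u \<le> exp (0.5285 + l - l * exp (- 0.5285))" using u by simp
  then show "l / 0.5285 < exp (0.5285 + l - l * exp (- 0.5285))" using e by linarith
qed simp

lemma t2_2406: "0.5283 < t2 2.406" "t2 2.406 < 0.5285"
proof -
  have "exp (1.5158 :: real) < 2.406 / 0.5283"
    using exp_upper_Taylor[of "1.5158" 11] by (simp add: eval_nat_numeral)
  then show "0.5283 < t2 2.406" by (intro t2_lower[of _ "1.5158"]) auto
  have "2.406 / 0.5285 < exp (1.516 :: real)"
    using exp_lower_Taylor[of "1.516" 11] by (simp add: eval_nat_numeral)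
  then show "t2 2.406 < 0.5285" by (intro t2_upper[of _ "1.516"]) auto
qed

lemma t2_2414: "0.5283 < t2 2.414" "t2 2.414 < 0.5285"
proof -
  have "exp (1.5191 :: real) < 2.414 / 0.5283"
    using exp_upper_Taylor[of "1.5191" 11] by (simp add: eval_nat_numeral)
  then show "0.5283 < t2 2.414" by (intro t2_lower[of _ "1.5191"]) auto
  have "2.414 / 0.5285 < exp (1.5193 :: real)"
    using exp_lower_Taylor[of "1.5193" 11] by (simp add: eval_nat_numeral)
  then show "t2 2.414 < 0.5285" by (intro t2_upper[of _ "1.5193"]) auto
qed

lemma slope_2406: "H2_slope 2.406 (c2 2.406) < 1"
proof -
  define t where "t = t2 2.406"
  define A where "A = A2 2.406"
  have t: "0.5283 < t" "t < 0.5285" using t2_2406 by (simp_all add: t_def)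
  have A0: "0 < A" by (simp add: A_def A2_def)
  have "1.696 \<le> exp t" using exp_5283 t by (smt (verit) exp_less_mono)
  then have "A \<le> 1.4187" by (simp add: A_def A2_def t_def exp_minus field_simps)
  then have "A * (A + 2 - t) - t \<le> 1.4187 * (1.4187 + 2 - 0.5283) - 0.5283"
    using t A0 by (intro diff_mono mult_mono) auto
  then have "A\<^sup>2 + 2 * A - t * (1 + A) \<le> 3.5727"
    by (simp add: algebra_simps power2_eq_square)
  moreover have "t\<^sup>2 \<le> 0.27932"
    using t mult_mono[of t "0.5285" t "0.5285"] by (simp add: power2_eq_square)
  ultimately have "t\<^sup>2 * (A\<^sup>2 + 2 * A - t * (1 + A)) \<le> t\<^sup>2 * 3.5727" "t\<^sup>2 * 3.5727 \<le> 0.27932 * 3.5727"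
    by (intro mult_left_mono mult_right_mono; simp)+
  then show ?thesis by (simp add: H2_slope_c2 t_def A_def)
qed

lemma slope_2414: "1 < H2_slope 2.414 (c2 2.414)"
proof -
  define t where "t = t2 2.414"
  define A where "A = A2 2.414"
  have t: "0.5283 < t" "t < 0.5285" using t2_2414 by (simp_all add: t_def)
  have "exp t \<le> 1.6964" using exp_5285 t by (smt (verit) exp_less_mono)
  then have A: "1.423 \<le> A" by (simp add: A_def A2_def t_def exp_minus field_simps)
  then have "1.423 * (1.423 + 2 - 0.5285) - 0.5285 \<le> A * (A + 2 - t) - t"
    using t by (intro diff_mono mult_mono) auto
  then have *: "3.59 \<le> A\<^sup>2 + 2 * A - t * (1 + A)"
    by (simp add: algebra_simps power2_eq_square)
  have "0.2791 \<le> t\<^sup>2"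
    using t mult_mono[of "0.5283" t "0.5283" t] by (simp add: power2_eq_square)
  then have "0.2791 * 3.59 \<le> t\<^sup>2 * (A\<^sup>2 + 2 * A - t * (1 + A))"
    using * by (intro mult_mono) auto
  then show ?thesis by (simp add: H2_slope_c2 t_def A_def)
qed

section \<open>The critical parameter\<close>

lemma H2_less:
  assumes l: "0 < l" and "0 \<le> x" "x < y"
  shows "H2 l x < H2 l y"
proof (rule DERIV_pos_imp_increasing[OF \<open>x < y\<close>])
  fix u assume "x \<le> u" "u \<le> y"
  then show "\<exists>D. (H2 l has_real_derivative D) (at u) \<and> 0 < D"
    using H2_deriv[of l u] H2_slope_pos[OF l, of u] assms by auto
qed

lemma H2_mono: "0 < l \<Longrightarrow> 0 \<le> x \<Longrightarrow> x \<le> y \<Longrightarrow> H2 l x \<le> H2 l y"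
  using H2_less[of l x y] by (cases "x = y") auto

lemma H2_iterates_bounded:
  assumes l: "0 < l" and x: "0 \<le> x" "H2 l x \<le> x"
  shows "0 \<le> (H2 l ^^ n) 0 \<and> (H2 l ^^ n) 0 \<le> x"
proof (induction n)
  case (Suc n)
  then have "H2 l ((H2 l ^^ n) 0) \<le> H2 l x" using l by (intro H2_mono) auto
  then show ?case using x H2_pos[of l "(H2 l ^^ n) 0"] by simp
qed (use x in simp)

lemma H2_iterates_limit_bounds:
  assumes "0 < l" "0 \<le> x" "H2 l x \<le> x" "(\<lambda>n. (H2 l ^^ n) 0) \<longlonglongrightarrow> L"
  shows "0 \<le> L" "L \<le> x"
  using H2_iterates_bounded[OF assms(1-3)] assms(4)
  by (blast intro: LIMSEQ_le_const LIMSEQ_le_const2)+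

lemma H2_iterates_limit_fixed:
  assumes "(\<lambda>n. (H2 l ^^ n) 0) \<longlonglongrightarrow> L"
  shows "H2 l L = L"
proof -
  have "isCont (H2 l) L" using H2_deriv by (rule DERIV_isCont)
  then have "(\<lambda>n. (H2 l ^^ Suc n) 0) \<longlonglongrightarrow> H2 l L"
    using isCont_tendsto_compose[OF _ assms] by simp
  then show ?thesis using LIMSEQ_unique LIMSEQ_Suc[OF assms] by blast
qed

text \<open>
  The iterates increase to a fixed point \<open>L \<le> c2 l\<close>. If \<open>L < c2 l\<close>, the mean slope between these two
  fixed points would be 1, but it is below the slope at \<open>c2 l\<close>.
\<close>

lemma nd2_eq_0:
  assumes l: "2 \<le> l" and slope: "H2_slope l (c2 l) \<le> 1"
  shows "nd2 l = 0"
proof -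
  have l0: "0 < l" using l by simp
  obtain L where L: "(\<lambda>n. (H2 l ^^ n) 0) \<longlonglongrightarrow> L" "nd2 l = F2 l L - L"
    using nd2_eq[OF l0] .
  have fixed: "H2 l L = L" using L(1) by (rule H2_iterates_limit_fixed)
  have bounds: "0 \<le> L" "L \<le> c2 l"
    using H2_iterates_limit_bounds[OF l0 _ _ L(1), of "c2 l"] c2[OF l0] H2_c2[OF l0] by auto
  have "L = c2 l"
  proof (rule ccontr)
    assume "L \<noteq> c2 l"
    then have "L < c2 l" using bounds by simp
    then obtain u where u: "L < u" "u < c2 l" "H2 l (c2 l) - H2 l L = (c2 l - L) * H2_slope l u"
      using MVT2[of L "c2 l" "H2 l" "H2_slope l"] H2_deriv by blast
    have "H2_slope l u < H2_slope l (c2 l)" using H2_slope_less[OF l, of u "c2 l"] u bounds by simp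
    then have "H2_slope l u < 1" using slope by simp
    then have "(c2 l - L) * H2_slope l u < (c2 l - L) * 1"
      using \<open>L < c2 l\<close> by (intro mult_strict_left_mono) auto
    then show False using u(3) fixed H2_c2[OF l0] by simp
  qed
  then show ?thesis using L(2) c2(3)[OF l0] by simp
qed

lemma nd2_pos:
  assumes l: "0 < l" and slope: "1 < H2_slope l (c2 l)"
  shows "0 < nd2 l"
proof -
  have "((\<lambda>x. H2 l x - x) has_real_derivative H2_slope l (c2 l) - 1) (at (c2 l))"
    by (intro derivative_intros H2_deriv)
  then obtain d where d: "0 < d"
    "\<And>h. 0 < h \<Longrightarrow> h < d \<Longrightarrow> H2 l (c2 l - h) - (c2 l - h) < H2 l (c2 l) - c2 l"
    using DERIV_pos_inc_left[of "\<lambda>x. H2 l x - x" "H2_slope l (c2 l) - 1" "c2 l"] slope by auto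
  define h where "h = min (d / 2) (c2 l / 2)"
  have h: "0 < h" "h < d" "h < c2 l" using d(1) c2[OF l] by (auto simp: h_def min_def)
  have "H2 l (c2 l - h) \<le> c2 l - h" using d(2)[OF h(1,2)] H2_c2[OF l] by simp
  moreover obtain L where L: "(\<lambda>n. (H2 l ^^ n) 0) \<longlonglongrightarrow> L" "nd2 l = F2 l L - L"
    using nd2_eq[OF l] .
  ultimately have "L < c2 l"
    using H2_iterates_limit_bounds(2)[OF l, of "c2 l - h" L] h by simp
  then show ?thesis using L(2) c2_less_F2_iff[OF l] by simp
qed

lemma slope_c2_less: "1 \<le> r \<Longrightarrow> r < s \<Longrightarrow> H2_slope r (c2 r) < H2_slope s (c2 s)"
  using slope_c2_strict_mono by (auto simp: strict_mono_on_def)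

lemma critical_exists: "\<exists>lc. critical lc \<and> 2.406 \<le> lc \<and> lc \<le> 2.414"
proof -
  define S where "S = {l. 2 \<le> l \<and> H2_slope l (c2 l) \<le> 1}"
  have bd: "l \<le> 2.414" if "l \<in> S" for l
    using that slope_2414 slope_c2_less[of "2.414" l] by (force simp: S_def)
  then have bdd: "bdd_above S" by (rule bdd_aboveI)
  have mem: "2.406 \<in> S" using slope_2406 by (simp add: S_def)
  have lo: "2.406 \<le> Sup S" using mem bdd by (rule cSup_upper)
  have "nd2 l = 0" if l: "2 \<le> l" "l < Sup S" for l
  proof -
    obtain l' where "l' \<in> S" "l < l'" using less_cSupD[of S l] mem l by auto
    then have "H2_slope l (c2 l) \<le> 1" using slope_c2_less[of l l'] l by (simp add: S_def)
    then show ?thesis using nd2_eq_0 l by simp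
  qed
  moreover have "0 < nd2 l" if l: "Sup S < l" for l
  proof -
    have "l \<notin> S" using cSup_upper[OF _ bdd, of l] l by auto
    then show ?thesis using lo l by (intro nd2_pos) (auto simp: S_def)
  qed
  moreover have "Sup S \<le> 2.414" using mem bd by (intro cSup_least) auto
  ultimately show ?thesis using lo by (auto simp: critical_def)
qed

text \<open>
  The hypothesis \<open>2 < y\<close> leaves room for a parameter at least 2 between the two candidates.
\<close>

lemma critical_unique:
  assumes "critical x" "critical y" "2 < y"
  shows "x = y"
proof (rule ccontr)
  assume "x \<noteq> y"
  then obtain l where "2 \<le> l" "(l < y \<and> x < l) \<or> (y < l \<and> l < x)"
  proof (cases x y rule: linorder_cases)
    case less
    then show ?thesis using that[of "(max x 2 + y) / 2"] assms(3) by (auto simp: max_def)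
  next
    case greater
    then show ?thesis using that[of "(x + y) / 2"] assms(3) by auto
  qed simp
  then show False using assms unfolding critical_def by force
qed

theorem theorem1p5:
  shows "(\<forall>l\<ge>2. strict_convex_on {0..c2 l} (H2 l)) \<and>
         strict_mono_on {1..} (\<lambda>l. deriv (H2 l) (c2 l)) \<and>
         (\<exists>!lc. critical lc) \<and>
         (\<forall>lc. critical lc \<longrightarrow> \<bar>lc - 2.41\<bar> < 0.005)"
proof -
  obtain lc where lc: "critical lc" "2.406 \<le> lc" "lc \<le> 2.414" using critical_exists by blast
  have unique: "x = lc" if "critical x" for x using critical_unique[OF that lc(1)] lc(2) by simp
  have "deriv (H2 l) (c2 l) = H2_slope l (c2 l)" for l using H2_deriv by (rule DERIV_imp_deriv)
  then have "strict_mono_on {1..} (\<lambda>l. deriv (H2 l) (c2 l))" using slope_c2_strict_mono by simp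
  moreover have "\<exists>!lc. critical lc" using lc(1) unique by blast
  moreover have "\<bar>x - 2.41\<bar> < 0.005" if "critical x" for x
    using unique[OF that] lc unfolding abs_less_iff by simp
  ultimately show ?thesis using H2_strict_convex by blast
qed

end
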